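(* For any $q_1,q_2\in\mathcal{E}_p$ (whose $m$-projections onto $\mathcal{N}$ exist), let $\theta_i$ denote the natural parameters of the $m$-projections $p_{\theta_i}=\pi^{(m)}(q_i)$ and let $S_i=\mathcal{F}(\theta_i)$, $i=1,2$. Then $$d_{\mathrm{AIRM}}(S_1,S_2)\le\tilde d(q_1,q_2).$$ Equality holds if and only if the AIRM geodesic connecting $S_1$ and $S_2$ in $\mathrm{SPD}(d+1)$ lies entirely within $\mathcal{M}=\mathcal{F}(\mathcal{N})$.
   Context: Let $(X,\mathcal{X},\mu)$ be a $\sigma$-finite measure space and let $\mathcal{M}_\mu$ be the set of measurable $p:X\to\mathbb{R}$ with $p>0$ $\mu$-a.e. and $\int_X p\,d\mu=1$. For $p\in\mathcal{M}_\mu$ write $\mathbb{E}_p[u]=\int_X u\,p\,d\mu$ (entrywise for matrices). Fix a reference density $p\in\mathcal{M}_\mu$. Let $B_p$ be the Banach space of ($\mu$-a.e. classes of) measurable $u:X\to\mathbb{R}$ such that $\mathbb{E}_p[\cosh(\alpha u)-1]<\infty$ for some $\alpha>0$ and $\mathbb{E}_p[u]=0$, with norm $\|u\|_p=\inf\{r>0:\mathbb{E}_p[\cosh(u/r)-1]\le 1\}$. For $u\in B_p$ let $K_p(u)=\log\mathbb{E}_p[e^u]\in[0,+\infty]$, $\mathrm{Dom}(K_p)=\{u\in B_p:K_p(u)<\infty\}$, with interior $\mathrm{Dom}(K_p)^\circ$ in $B_p$. The maximal exponential model is $\mathcal{E}_p=\{e^{u-K_p(u)}p:u\in\mathrm{Dom}(K_p)^\circ\}$.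 Fix $d\ge 1$ and $u_1,\ldots,u_d\in B_p$ linearly independent in $L^2(p\cdot\mu)$ (standing assumption). Let $\Theta=\{\theta\in\mathbb{R}^d:\sum_j\theta_ju_j\in\mathrm{Dom}(K_p)^\circ\}$ (open), $\psi(\theta)=K_p(\sum_j\theta_ju_j)$, $p_\theta=e^{\sum_j\theta_ju_j-\psi(\theta)}p$, $\mathcal{N}=\{p_\theta:\theta\in\Theta\}$. With $D_{\mathrm{KL}}(q\|r)=\int_X q\log(q/r)\,d\mu$, the $m$-projection of $q\in\mathcal{E}_p$ is $\pi^{(m)}(q)=\arg\min_{p_\theta\in\mathcal{N}}D_{\mathrm{KL}}(q\|p_\theta)$; the minimizer is unique whenever it exists. Let $V(x)=(u_1(x),\ldots,u_d(x),1)^\top$ and $\mathcal{F}:\mathcal{N}\to\mathrm{SPD}(d+1)$, $\mathcal{F}(\theta)=\mathcal{F}(p_\theta)=S(\theta)=\mathbb{E}_{p_\theta}[VV^\top]$, where $\mathrm{SPD}(m)$ is the set of real symmetric positive definite $m\times m$ matrices. The affine-invariant Riemannian metric (AIRM) is $\langle\Xi,\Omega\rangle_S=\frac12\mathrm{tr}(S^{-1}\Xi S^{-1}\Omega)$; its unique geodesic from $S_0$ to $S_1$ is $\gamma(t)=S_0^{1/2}(S_0^{-1/2}S_1S_0^{-1/2})^tS_0^{1/2}$, $t\in[0,1]$, and its distance is $d_{\mathrm{AIRM}}(S_0,S_1)=\frac{1}{\sqrt2}\|\log(S_0^{-1/2}S_1S_0^{-1/2})\|_F$. The pullback metric on $\Theta$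 is $g^{\mathcal{F}}_{jk}(\theta)=\frac12\mathrm{tr}\left(S^{-1}\frac{\partial S}{\partial\theta_j}S^{-1}\frac{\partial S}{\partial\theta_k}\right)$, and $d_{\mathcal{F}}(p_{\theta_1},p_{\theta_2})=\inf_\gamma\int_0^1\sqrt{g^{\mathcal{F}}_{\gamma(t)}(\dot\gamma(t),\dot\gamma(t))}\,dt$ over smooth paths $\gamma:[0,1]\to\Theta$ from $\theta_1$ to $\theta_2$. The pseudo-metric is $\tilde d(q_1,q_2):=d_{\mathcal{F}}(\pi^{(m)}(q_1),\pi^{(m)}(q_2))$. *)

theory Defs
  imports "HOL-Analysis.Analysis"
begin

section \<open>The maximal exponential model\<close>

text \<open>
  Random variables and densities are represented by measurable functions rather than by their
  almost everywhere classes; the measure \<open>\<mu>\<close> is \<open>M\<close>, with underlying set \<open>space M\<close>.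
\<close>

definition densities :: "'x measure \<Rightarrow> ('x \<Rightarrow> real) set" where
  "densities M = {p \<in> borel_measurable M.
     (AE x in M. 0 < p x) \<and> integrable M p \<and> (\<integral>x. p x \<partial>M) = 1}"

definition expect :: "'x measure \<Rightarrow> ('x \<Rightarrow> real) \<Rightarrow> ('x \<Rightarrow> real) \<Rightarrow> real" where
  "expect M p f = (\<integral>x. f x * p x \<partial>M)"

text \<open>
  Expectation of a nonnegative \<open>f\<close>, with value \<open>\<infinity>\<close> allowed: the Bochner integral would be \<open>0\<close>
  for a non-integrable function.
\<close>

definition nn_expect :: "'x measure \<Rightarrow> ('x \<Rightarrow> real) \<Rightarrow> ('x \<Rightarrow> real) \<Rightarrow> ennreal" where
  "nn_expect M p f = (\<integral>\<^sup>+x. ennreal (f x * p x) \<partial>M)"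

definition B_space :: "'x measure \<Rightarrow> ('x \<Rightarrow> real) \<Rightarrow> ('x \<Rightarrow> real) set" where
  "B_space M p = {u \<in> borel_measurable M.
     (\<exists>\<alpha>>0. nn_expect M p (\<lambda>x. cosh (\<alpha> * u x) - 1) < \<infinity>) \<and> expect M p u = 0}"

definition B_norm :: "'x measure \<Rightarrow> ('x \<Rightarrow> real) \<Rightarrow> ('x \<Rightarrow> real) \<Rightarrow> real" where
  "B_norm M p u = Inf {r. 0 < r \<and> nn_expect M p (\<lambda>x. cosh (u x / r) - 1) \<le> 1}"

definition K :: "'x measure \<Rightarrow> ('x \<Rightarrow> real) \<Rightarrow> ('x \<Rightarrow> real) \<Rightarrow> ereal" where
  "K M p u = (let e = nn_expect M p (\<lambda>x. exp (u x)) in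
     if e = \<infinity> then \<infinity> else ereal (ln (enn2real e)))"

definition Dom_K :: "'x measure \<Rightarrow> ('x \<Rightarrow> real) \<Rightarrow> ('x \<Rightarrow> real) set" where
  "Dom_K M p = {u \<in> B_space M p. K M p u < \<infinity>}"

text \<open>
  On functions \<open>B_norm\<close> is only a seminorm, so the interior is written out with balls; the set
  below is the preimage of the interior in the Banach space of classes.
\<close>

definition Dom_K_interior :: "'x measure \<Rightarrow> ('x \<Rightarrow> real) \<Rightarrow> ('x \<Rightarrow> real) set" where
  "Dom_K_interior M p = {u \<in> B_space M p.
     \<exists>\<epsilon>>0. \<forall>v \<in> B_space M p. B_norm M p (\<lambda>x. v x - u x) < \<epsilon> \<longrightarrow> v \<in> Dom_K M p}"

definition tilt :: "'x measure \<Rightarrow> ('x \<Rightarrow> real) \<Rightarrow> ('x \<Rightarrow> real) \<Rightarrow> 'x \<Rightarrow> real" where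
  "tilt M p u = (\<lambda>x. exp (u x - real_of_ereal (K M p u)) * p x)"

definition max_exp_model :: "'x measure \<Rightarrow> ('x \<Rightarrow> real) \<Rightarrow> ('x \<Rightarrow> real) set" where
  "max_exp_model M p = {q \<in> borel_measurable M.
     \<exists>u \<in> Dom_K_interior M p. AE x in M. q x = tilt M p u x}"


section \<open>The finite-dimensional exponential family and the m-projection\<close>

definition lin_comb :: "('d::finite \<Rightarrow> 'x \<Rightarrow> real) \<Rightarrow> real^'d \<Rightarrow> 'x \<Rightarrow> real" where
  "lin_comb u \<theta> = (\<lambda>x. \<Sum>j\<in>UNIV. \<theta> $ j * u j x)"

definition lin_indep_L2 ::
    "'x measure \<Rightarrow> ('x \<Rightarrow> real) \<Rightarrow> ('d::finite \<Rightarrow> 'x \<Rightarrow> real) \<Rightarrow> bool" where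
  "lin_indep_L2 M p u \<longleftrightarrow>
     (\<forall>c. (AE x in density M (\<lambda>x. ennreal (p x)). lin_comb u c x = 0) \<longrightarrow> c = 0)"

definition param_space ::
    "'x measure \<Rightarrow> ('x \<Rightarrow> real) \<Rightarrow> ('d::finite \<Rightarrow> 'x \<Rightarrow> real) \<Rightarrow> (real^'d) set" where
  "param_space M p u = {\<theta>. lin_comb u \<theta> \<in> Dom_K_interior M p}"

definition p_at ::
    "'x measure \<Rightarrow> ('x \<Rightarrow> real) \<Rightarrow> ('d::finite \<Rightarrow> 'x \<Rightarrow> real) \<Rightarrow> real^'d \<Rightarrow> 'x \<Rightarrow> real" where
  "p_at M p u \<theta> = tilt M p (lin_comb u \<theta>)"

definition exp_family ::
    "'x measure \<Rightarrow> ('x \<Rightarrow> real) \<Rightarrow> ('d::finite \<Rightarrow> 'x \<Rightarrow> real) \<Rightarrow> ('x \<Rightarrow> real) set" where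
  "exp_family M p u = p_at M p u ` param_space M p u"

text \<open>
  For \<open>q\<close> and \<open>r\<close> in the maximal exponential model the integrand is integrable, so the
  Bochner integral is the usual (finite) Kullback--Leibler divergence.
\<close>

definition KL_div :: "'x measure \<Rightarrow> ('x \<Rightarrow> real) \<Rightarrow> ('x \<Rightarrow> real) \<Rightarrow> real" where
  "KL_div M q r = (\<integral>x. q x * ln (q x / r x) \<partial>M)"

definition has_m_projection ::
    "'x measure \<Rightarrow> ('x \<Rightarrow> real) \<Rightarrow> ('d::finite \<Rightarrow> 'x \<Rightarrow> real) \<Rightarrow> ('x \<Rightarrow> real) \<Rightarrow> bool" where
  "has_m_projection M p u q \<longleftrightarrow>
     (\<exists>r. is_arg_min (KL_div M q) (\<lambda>r. r \<in> exp_family M p u) r)"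

definition m_projection ::
    "'x measure \<Rightarrow> ('x \<Rightarrow> real) \<Rightarrow> ('d::finite \<Rightarrow> 'x \<Rightarrow> real) \<Rightarrow> ('x \<Rightarrow> real) \<Rightarrow> 'x \<Rightarrow> real" where
  "m_projection M p u q = arg_min (KL_div M q) (\<lambda>r. r \<in> exp_family M p u)"


section \<open>The affine-invariant Riemannian metric\<close>

definition diag :: "real^'n \<Rightarrow> real^'n^'n" where
  "diag e = (\<chi> i j. if i = j then e $ i else 0)"

text \<open>
  Spectral functional calculus for symmetric matrices; by the spectral theorem the matrix \<open>B\<close>
  exists, and it does not depend on the chosen orthogonal diagonalisation.
\<close>

definition mat_fun :: "(real \<Rightarrow> real) \<Rightarrow> real^'n^'n \<Rightarrow> real^'n^'n" where
  "mat_fun f A = (THE B. \<exists>P e. orthogonal_matrix P \<and>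
     A = P ** diag e ** transpose P \<and> B = P ** diag (\<chi> i. f (e $ i)) ** transpose P)"

definition mat_powr :: "real^'n^'n \<Rightarrow> real \<Rightarrow> real^'n^'n" where
  "mat_powr A t = mat_fun (\<lambda>x. x powr t) A"

definition mat_log :: "real^'n^'n \<Rightarrow> real^'n^'n" where
  "mat_log A = mat_fun ln A"

definition airm :: "real^'n^'n \<Rightarrow> real^'n^'n \<Rightarrow> real^'n^'n \<Rightarrow> real" where
  "airm S \<Xi> \<Omega> = 1/2 * trace (matrix_inv S ** \<Xi> ** matrix_inv S ** \<Omega>)"

definition airm_geodesic :: "real^'n^'n \<Rightarrow> real^'n^'n \<Rightarrow> real \<Rightarrow> real^'n^'n" where
  "airm_geodesic S0 S1 t = mat_powr S0 (1/2) **
     mat_powr (mat_powr S0 (-1/2) ** S1 ** mat_powr S0 (-1/2)) t ** mat_powr S0 (1/2)"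

text \<open>The norm of \<^typ>\<open>real^'n^'n\<close> is the Frobenius norm.\<close>

definition d_airm :: "real^'n^'n \<Rightarrow> real^'n^'n \<Rightarrow> real" where
  "d_airm S0 S1 = 1 / sqrt 2 * norm (mat_log (mat_powr S0 (-1/2) ** S1 ** mat_powr S0 (-1/2)))"


section \<open>The second-moment embedding and the pullback distance\<close>

text \<open>
  Vectors and matrices of size \<open>d + 1\<close> are indexed by \<^typ>\<open>'d option\<close>; the index \<^term>\<open>None\<close>
  carries the constant function \<open>1\<close>.
\<close>

definition V :: "('d::finite \<Rightarrow> 'x \<Rightarrow> real) \<Rightarrow> 'x \<Rightarrow> real^('d option)" where
  "V u x = (\<chi> i. case i of None \<Rightarrow> 1 | Some j \<Rightarrow> u j x)"

definition F_map ::
    "'x measure \<Rightarrow> ('d::finite \<Rightarrow> 'x \<Rightarrow> real) \<Rightarrow> ('x \<Rightarrow> real) \<Rightarrow> real^('d option)^('d option)" where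
  "F_map M u r = (\<chi> i j. expect M r (\<lambda>x. V u x $ i * V u x $ j))"

definition S_mat ::
    "'x measure \<Rightarrow> ('x \<Rightarrow> real) \<Rightarrow> ('d::finite \<Rightarrow> 'x \<Rightarrow> real) \<Rightarrow> real^'d
      \<Rightarrow> real^('d option)^('d option)" where
  "S_mat M p u \<theta> = F_map M u (p_at M p u \<theta>)"

definition partial_S ::
    "'x measure \<Rightarrow> ('x \<Rightarrow> real) \<Rightarrow> ('d::finite \<Rightarrow> 'x \<Rightarrow> real) \<Rightarrow> 'd \<Rightarrow> real^'d
      \<Rightarrow> real^('d option)^('d option)" where
  "partial_S M p u j \<theta> = vector_derivative (\<lambda>h. S_mat M p u (\<theta> + h *\<^sub>R axis j 1)) (at 0)"

definition pullback_metric ::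
    "'x measure \<Rightarrow> ('x \<Rightarrow> real) \<Rightarrow> ('d::finite \<Rightarrow> 'x \<Rightarrow> real) \<Rightarrow> real^'d \<Rightarrow> real^'d^'d" where
  "pullback_metric M p u \<theta> =
     (\<chi> j k. airm (S_mat M p u \<theta>) (partial_S M p u j \<theta>) (partial_S M p u k \<theta>))"

definition smooth_path :: "(real \<Rightarrow> 'a::real_normed_vector) \<Rightarrow> bool" where
  "smooth_path \<gamma> \<longleftrightarrow> (\<exists>D::nat \<Rightarrow> real \<Rightarrow> 'a. (\<forall>t\<in>{0..1}. D 0 t = \<gamma> t) \<and>
     (\<forall>k. \<forall>t\<in>{0..1}. (D k has_vector_derivative D (Suc k) t) (at t within {0..1})))"

definition pullback_length ::
    "'x measure \<Rightarrow> ('x \<Rightarrow> real) \<Rightarrow> ('d::finite \<Rightarrow> 'x \<Rightarrow> real) \<Rightarrow> (real \<Rightarrow> real^'d) \<Rightarrow> real" where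
  "pullback_length M p u \<gamma> = integral {0..1} (\<lambda>t.
     let v = vector_derivative \<gamma> (at t within {0..1})
     in sqrt (v \<bullet> (pullback_metric M p u (\<gamma> t) *v v)))"

text \<open>
  The parametrisation \<open>\<theta> \<mapsto> p\<^sub>\<theta>\<close> is injective on the parameter space, so the endpoint conditions
  fix the endpoints of \<open>\<gamma>\<close>.
\<close>

definition d_pullback ::
    "'x measure \<Rightarrow> ('x \<Rightarrow> real) \<Rightarrow> ('d::finite \<Rightarrow> 'x \<Rightarrow> real)
      \<Rightarrow> ('x \<Rightarrow> real) \<Rightarrow> ('x \<Rightarrow> real) \<Rightarrow> real" where
  "d_pullback M p u r1 r2 = Inf {pullback_length M p u \<gamma> | \<gamma>.
     smooth_path \<gamma> \<and> \<gamma> ` {0..1} \<subseteq> param_space M p u \<and>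
     p_at M p u (\<gamma> 0) = r1 \<and> p_at M p u (\<gamma> 1) = r2}"

definition d_tilde ::
    "'x measure \<Rightarrow> ('x \<Rightarrow> real) \<Rightarrow> ('d::finite \<Rightarrow> 'x \<Rightarrow> real)
      \<Rightarrow> ('x \<Rightarrow> real) \<Rightarrow> ('x \<Rightarrow> real) \<Rightarrow> real" where
  "d_tilde M p u q1 q2 = d_pullback M p u (m_projection M p u q1) (m_projection M p u q2)"

end

theory Submission
  imports Defs
begin

text \<open>
  The matrix \<open>\<F>(\<theta>)\<close> has the entry \<open>\<E>[1] = 1\<close> in its last diagonal position (the index \<open>None\<close>), for
  every \<open>\<theta>\<close>.
  This makes the equality case rigid: equality holds exactly when \<open>\<theta>1 = \<theta>2\<close>, and
  the geodesic stays in the image of the model exactly when \<open>\<theta>1 = \<theta>2\<close>.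

  The inequality. Fix an order of the coordinates and orthogonalise the unit vectors with respect to
  the form \<open>A\<close>. The squared lengths of the resulting vectors are the pivots of \<open>A\<close>, the diagonal of
  its \<open>L D L\<^sup>T\<close> factorisation. In the orthogonalised frame the logarithmic derivatives of the pivots
  along a path are the diagonal entries of a symmetric matrix whose Frobenius norm is \<open>\<surd>2\<close> times the
  speed of the path. So \<open>A \<mapsto> (log pivots)\<close> increases lengths by a factor of at most \<open>\<surd>2\<close>
  (\<open>log_pivots_increment_le\<close>). A congruence takes \<open>S\<^sub>1\<close> to the identity and \<open>S\<^sub>2\<close> to a
  diagonal matrix with entries \<open>w\<close>; there the log-pivots of the endpoints are \<open>0\<close> and \<open>ln w\<close>, and
  \<open>\<parallel>ln w\<parallel> = \<surd>2 d(S\<^sub>1, S\<^sub>2)\<close>.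

  The geodesic. In the same coordinates it is \<open>C\<^sup>T diag(w\<^sup>t) C\<close>, and its last diagonal entry is
  \<open>\<Sum>\<^sub>i c\<^sub>i\<^sup>2 w\<^sub>i\<^sup>t\<close>. If this is \<open>1\<close> at \<open>t = 0, 1/2, 1\<close>, then \<open>\<Sum>\<^sub>i c\<^sub>i\<^sup>2 (\<surd>w\<^sub>i - 1)\<^sup>2 = 0\<close>, so
  \<open>diag(w) c = c\<close>, and the last columns of \<open>S\<^sub>1\<close> and \<open>S\<^sub>2\<close> agree (\<open>columns_eq_if_geodesic_entry\<close>). These
  columns hold the means of the \<open>u\<^sub>j\<close>, and the means determine the parameter (\<open>mean_injective\<close>).

  Equality of the distances. The infimum that defines the pullback distance need not be attained, so
  the midpoint has to be recovered from almost minimal paths. By the parallelogram law the log-pivots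
  at half of the length of such a path are close to \<open>(ln w)/2\<close>, and this for every order of the
  coordinates at once. The different orders together determine all entries, so the halfway points
  converge to \<open>diag(\<surd>w)\<close>. The entry \<open>1\<close> survives in the limit, and the computation for the geodesic
  applies again (\<open>columns_eq_if_distance_approximated\<close>).

  The analytic input is that \<open>\<theta> \<mapsto> \<F>(\<theta>)\<close> is continuously differentiable on the parameter space, so that
  the pullback length is the length of the image path. At an interior point \<open>\<theta>\<close> the function
  \<open>exp(\<theta>\<cdot>u + s \<Sum>\<^sub>j \<bar>u\<^sub>j\<bar>)\<close> is \<open>p\<close>-integrable for some \<open>s > 0\<close>, and this dominates the second-order
  remainder of every moment (\<open>param_space_regular\<close>, \<open>moment_derivative\<close>).
\<close>

section \<open>Symmetric matrices and the affine-invariant metric\<close>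

text \<open>
  A maximiser of the Rayleigh quotient on the unit sphere of the orthogonal complement of \<open>B\<close> is an
  eigenvector: the complement is invariant because \<open>B\<close> consists of eigenvectors of a symmetric matrix.
\<close>
lemma max_rayleigh_eigenvector:
  fixes A :: "real^'n^'n"
  assumes sym: "transpose A = A" and B: "\<And>b. b \<in> B \<Longrightarrow> \<exists>l. A *v b = l *\<^sub>R b"
    and dim: "dim B < CARD('n)"
  shows "\<exists>x l. norm x = 1 \<and> A *v x = l *\<^sub>R x \<and> (\<forall>b\<in>B. b \<bullet> x = 0)"
proof -
  have adj: "(A *v x) \<bullet> y = x \<bullet> (A *v y)" for x y
    by (metis dot_lmul_matrix sym transpose_matrix_vector)
  define T where "T = {x. \<forall>b\<in>B. b \<bullet> x = 0}"
  have subT: "a *\<^sub>R x + c *\<^sub>R y \<in> T" if "x \<in> T" "y \<in> T" for x y a c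
    using that by (auto simp: T_def inner_add_right)
  have AT: "A *v x \<in> T" if x: "x \<in> T" for x
  proof -
    have "b \<bullet> (A *v x) = 0" if b: "b \<in> B" for b
    proof -
      obtain l where l: "A *v b = l *\<^sub>R b" using B[OF b] ..
      have "b \<bullet> (A *v x) = (A *v b) \<bullet> x" by (rule adj[symmetric])
      also have "\<dots> = l * (b \<bullet> x)" unfolding l by (rule inner_scaleR_left)
      also have "b \<bullet> x = 0" using x b by (simp add: T_def)
      finally show ?thesis by simp
    qed
    then show ?thesis by (simp add: T_def)
  qed
  have "dim B < DIM(real^'n)" using dim by simp
  then obtain z where z: "z \<noteq> 0" "\<And>y. y \<in> span B \<Longrightarrow> orthogonal z y"
    by (rule orthogonal_to_subspace_exists) blast
  have "z \<in> T"
    using z(2)[OF span_base] by (simp add: T_def orthogonal_def inner_commute)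
  define S where "S = sphere 0 1 \<inter> T"
  have "closed T"
  proof -
    have "T = (\<Inter>b\<in>B. {x. b \<bullet> x = 0})" by (auto simp: T_def)
    then show ?thesis by (auto intro!: closed_INT closed_hyperplane)
  qed
  then have "compact S" unfolding S_def by (intro compact_Int_closed) auto
  moreover have "(1 / norm z) *\<^sub>R z \<in> S"
    using subT[OF \<open>z \<in> T\<close> \<open>z \<in> T\<close>, of "1 / norm z" 0] z(1) by (simp add: S_def)
  then have "S \<noteq> {}" by blast
  moreover have "continuous_on S (\<lambda>x. x \<bullet> (A *v x))"
    by (intro continuous_intros linear_continuous_on_compose matrix_vector_mul_linear)
  ultimately obtain x where x: "x \<in> S" "\<And>y. y \<in> S \<Longrightarrow> y \<bullet> (A *v y) \<le> x \<bullet> (A *v x)"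
    using continuous_attains_sup by metis
  define l where "l = x \<bullet> (A *v x)"
  have nx: "norm x = 1" and xT: "x \<in> T" using x(1) by (auto simp: S_def)
  define q where "q y = l * (y \<bullet> y) - y \<bullet> (A *v y)" for y
  have q_nonneg: "0 \<le> q y" if "y \<in> T" for y
  proof (cases "y = 0")
    case False
    let ?y = "(1 / norm y) *\<^sub>R y"
    have "?y \<in> S" using subT[OF that that, of "1 / norm y" 0] False by (simp add: S_def)
    from x(2)[OF this] have "?y \<bullet> (A *v ?y) \<le> l" unfolding l_def .
    then have "(y \<bullet> (A *v y)) / (norm y)^2 \<le> l"
      by (simp add: matrix_vector_mult_scaleR power2_eq_square)
    then have "y \<bullet> (A *v y) \<le> l * (norm y)^2" using False by (simp add: divide_le_eq)
    then show ?thesis by (simp add: q_def power2_norm_eq_inner)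
  qed (simp add: q_def)
  \<comment> \<open>The nonnegative form \<open>q\<close> vanishes at the maximiser, hence so does its polar form there.\<close>
  have polar: "l * (x \<bullet> y) - x \<bullet> (A *v y) = 0" if "y \<in> T" for y
  proof (rule ccontr)
    let ?k = "l * (x \<bullet> y) - x \<bullet> (A *v y)"
    assume k: "?k \<noteq> 0"
    have qx: "q x = 0" using nx by (simp add: q_def l_def flip: power2_norm_eq_inner)
    have expand: "q (x + s *\<^sub>R y) = 2 * s * ?k + s^2 * q y" for s
    proof -
      have "y \<bullet> (A *v x) = x \<bullet> (A *v y)" by (metis adj inner_commute)
      then have "q (x + s *\<^sub>R y) = q x + 2 * s * ?k + s^2 * q y"
        by (simp add: q_def inner_add_left inner_add_right matrix_vector_right_distrib
            matrix_vector_mult_scaleR inner_commute[of y x]) (simp add: algebra_simps power2_eq_square)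
      then show ?thesis by (simp only: qx)
    qed
    have nn: "0 \<le> 2 * s * ?k + s^2 * q y" for s
      using q_nonneg[OF subT[OF xT that, of 1 s]] by (simp add: expand)
    have qy: "0 \<le> q y" by (rule q_nonneg[OF that])
    have alg: "2 * (- k / (b + 1)) * k + (- k / (b + 1))^2 * b = - (k^2) * (b + 2) / (b + 1)^2"
      if "0 \<le> b" for k b :: real
    proof -
      have "b + 1 \<noteq> 0" using that by simp
      then show ?thesis by (simp add: divide_simps) (simp add: algebra_simps power2_eq_square)
    qed
    \<comment> \<open>At \<open>-?k / q y\<close> the quadratic is minimal; adding \<open>1\<close> avoids a zero denominator and still
      leaves a negative value.\<close>
    define s where "s = - ?k / (q y + 1)"
    have "2 * s * ?k + s^2 * q y = - (?k^2) * (q y + 2) / (q y + 1)^2"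
      unfolding s_def by (rule alg[OF qy])
    also have "\<dots> < 0"
      using qy k by (intro divide_neg_pos mult_neg_pos) auto
    finally show False using nn[of s] by simp
  qed
  have "A *v x - l *\<^sub>R x \<in> T" using subT[OF AT[OF xT] xT, of 1 "-l"] by simp
  from polar[OF this] have "(A *v x - l *\<^sub>R x) \<bullet> (A *v x - l *\<^sub>R x) = 0"
    using adj[of x "A *v x - l *\<^sub>R x"] by (simp add: inner_diff_left inner_commute)
  then have "A *v x = l *\<^sub>R x" by simp
  then show ?thesis using nx xT by (auto simp: T_def)
qed

lemma orthonormal_eigenvectors:
  fixes A :: "real^'n^'n"
  assumes sym: "transpose A = A" and "k \<le> CARD('n)"
  shows "\<exists>B. finite B \<and> card B = k \<and> pairwise orthogonal B \<and>
    (\<forall>b\<in>B. norm b = 1 \<and> (\<exists>l. A *v b = l *\<^sub>R b))"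
  using assms(2)
proof (induction k)
  case 0
  then show ?case by (intro exI[of _ "{}"]) auto
next
  case (Suc k)
  then obtain B where B: "finite B" "card B = k" "pairwise orthogonal B"
    "\<forall>b\<in>B. norm b = 1 \<and> (\<exists>l. A *v b = l *\<^sub>R b)" by auto
  have "dim B < CARD('n)" using dim_le_card'[OF B(1)] B(2) Suc.prems by simp
  then obtain x l where x: "norm x = 1" "A *v x = l *\<^sub>R x" "\<forall>b\<in>B. b \<bullet> x = 0"
    using max_rayleigh_eigenvector[OF sym, of B] B(4) by blast
  have "x \<notin> B"
  proof
    assume "x \<in> B" then have "x = 0" using x(3) by auto
    then show False using x(1) by simp
  qed
  then show ?case using B x
    by (intro exI[of _ "insert x B"])
       (auto simp: pairwise_insert orthogonal_def[abs_def] inner_commute)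
qed

lemma matrix_cancel_left: "X ** Y = mat 1 \<Longrightarrow> X ** (Y ** Z) = Z"
  for X :: "real^'n^'n" and Z :: "real^'m^'n"
  by (simp add: matrix_mul_assoc)

lemma diag_nth: "diag e $ i $ j = (if i = j then e $ i else 0)"
  by (simp add: diag_def)

lemma mult_diag_nth: "(A ** diag e) $ i $ j = A $ i $ j * e $ j" for A :: "real^'n^'m"
  by (simp add: matrix_matrix_mult_def diag_nth mult_delta_right)

lemma diag_mult_nth: "(diag e ** A) $ i $ j = e $ i * A $ i $ j" for A :: "real^'n^'m"
  by (simp add: matrix_matrix_mult_def diag_nth if_distrib [of "\<lambda>x. x * _"] cong: if_cong)

lemma diag_mult_diag: "diag a ** diag b = diag (\<chi> i. a $ i * b $ i)"
  by (simp add: vec_eq_iff mult_diag_nth diag_nth)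

lemma diag_one: "diag (\<chi> i. 1) = mat 1"
  by (simp add: vec_eq_iff diag_nth mat_def)

lemma transpose_diag: "transpose (diag e) = diag e"
  by (simp add: vec_eq_iff diag_nth transpose_def)

lemma spectral_theorem:
  fixes A :: "real^'n^'n"
  assumes sym: "transpose A = A"
  obtains P e where "orthogonal_matrix P" "A = P ** diag e ** transpose P"
proof -
  obtain B where B: "finite B" "card B = CARD('n)" "pairwise orthogonal B"
    "\<forall>b\<in>B. norm b = 1 \<and> (\<exists>l. A *v b = l *\<^sub>R b)"
    using orthonormal_eigenvectors[OF sym order_refl] by blast
  obtain f where f: "bij_betw f (UNIV :: 'n set) B"
    using finite_same_card_bij[of "UNIV :: 'n set" B] B by auto
  have fB: "f j \<in> B" for j using f by (auto simp: bij_betw_def)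
  have "\<forall>j. \<exists>l. A *v f j = l *\<^sub>R f j" using B(4) fB by blast
  from choice[OF this] obtain e where e: "\<And>j. A *v f j = e j *\<^sub>R f j" by blast
  define P :: "real^'n^'n" where "P = (\<chi> i j. f j $ i)"
  have col: "column j P = f j" for j by (simp add: P_def column_def vec_eq_iff)
  have "orthogonal (f i) (f j)" if "i \<noteq> j" for i j
    using B(3) fB that f by (metis bij_betw_def injD pairwiseD)
  then have P: "orthogonal_matrix P"
    using B(4) fB by (simp add: orthogonal_matrix_orthonormal_columns col)
  have "A ** P = P ** diag (\<chi> j. e j)"
  proof -
    have "(A ** P) $ i $ j = (P ** diag (\<chi> j. e j)) $ i $ j" for i j
    proof -
      have "(A ** P) $ i $ j = (A *v f j) $ i"
        by (simp add: matrix_matrix_mult_def matrix_vector_mult_def P_def)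
      also have "\<dots> = e j * f j $ i" by (simp add: e)
      finally show ?thesis by (simp add: mult_diag_nth P_def)
    qed
    then show ?thesis by (simp add: vec_eq_iff)
  qed
  then have "A ** (P ** transpose P) = P ** diag (\<chi> j. e j) ** transpose P"
    by (simp add: matrix_mul_assoc)
  then have "A = P ** diag (\<chi> j. e j) ** transpose P"
    using P by (simp add: orthogonal_matrix_def)
  with P that show ?thesis by blast
qed

text \<open>
  The functional calculus does not depend on the diagonalisation chosen, so any convenient one can be
  used to evaluate powers and logarithms.
\<close>
lemma mat_fun_diagonalised:
  fixes P :: "real^'n^'n"
  assumes P: "orthogonal_matrix P"
  shows "mat_fun f (P ** diag e ** transpose P) = P ** diag (\<chi> i. f (e $ i)) ** transpose P"
  unfolding mat_fun_def
proof (rule the_equality)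
  fix B
  assume "\<exists>Q d. orthogonal_matrix Q \<and> P ** diag e ** transpose P = Q ** diag d ** transpose Q \<and>
    B = Q ** diag (\<chi> i. f (d $ i)) ** transpose Q"
  then obtain Q d where Q: "orthogonal_matrix Q"
    and eq: "P ** diag e ** transpose P = Q ** diag d ** transpose Q"
    and B: "B = Q ** diag (\<chi> i. f (d $ i)) ** transpose Q" by blast
  have P': "transpose P ** P = mat 1" "P ** transpose P = mat 1"
    and Q': "transpose Q ** Q = mat 1" "Q ** transpose Q = mat 1"
    using P Q by (auto simp: orthogonal_matrix_def)
  define R where "R = transpose Q ** P"
  have "R ** diag e = transpose Q ** (P ** diag e ** transpose P) ** P"
    by (simp add: R_def matrix_mul_assoc[symmetric] P')
  also have "\<dots> = diag d ** R"
    unfolding eq by (simp add: R_def matrix_mul_assoc[symmetric] matrix_cancel_left[OF Q'(1)])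
  finally have "(R ** diag e) $ i $ j = (diag d ** R) $ i $ j" for i j by simp
  \<comment> \<open>Where \<open>R\<close> has a nonzero entry the two eigenvalues agree, so \<open>R\<close> also intertwines
    the transformed diagonal matrices.\<close>
  then have *: "R $ i $ j * e $ j = d $ i * R $ i $ j" for i j
    by (simp add: mult_diag_nth diag_mult_nth)
  have "R $ i $ j * f (e $ j) = f (d $ i) * R $ i $ j" for i j
    using *[of i j] by (cases "R $ i $ j = 0") auto
  then have "R ** diag (\<chi> i. f (e $ i)) = diag (\<chi> i. f (d $ i)) ** R"
    by (simp add: vec_eq_iff mult_diag_nth diag_mult_nth)
  then have "Q ** (R ** diag (\<chi> i. f (e $ i))) ** transpose P
      = Q ** (diag (\<chi> i. f (d $ i)) ** R) ** transpose P" by simp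
  moreover have "Q ** R = P"
    by (simp add: R_def matrix_cancel_left[OF Q'(2)])
  moreover have "R ** transpose P = transpose Q"
    by (simp add: R_def matrix_mul_assoc[symmetric] P')
  ultimately show "B = P ** diag (\<chi> i. f (e $ i)) ** transpose P"
    unfolding B by (simp add: matrix_mul_assoc)
      (simp add: matrix_mul_assoc[symmetric])
qed (use P in blast)

definition spd :: "real^'n^'n \<Rightarrow> bool" where
  "spd A \<longleftrightarrow> transpose A = A \<and> (\<forall>x. x \<noteq> 0 \<longrightarrow> 0 < x \<bullet> (A *v x))"

lemma inner_vector_matrix_mult: "x \<bullet> (y v* A) = (A *v x) \<bullet> y" for A :: "real^'n^'m"
  using dot_lmul_matrix[of y A x] by (simp add: inner_commute)

lemma spd_congruence:
  assumes "spd A" and inj: "\<And>x. B *v x = 0 \<Longrightarrow> x = 0"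
  shows "spd (transpose B ** A ** B)"
proof -
  have "transpose (transpose B ** A ** B) = transpose B ** A ** B"
    using assms(1) by (simp add: spd_def matrix_transpose_mul transpose_transpose matrix_mul_assoc)
  moreover have "0 < x \<bullet> ((transpose B ** A ** B) *v x)" if "x \<noteq> 0" for x
  proof -
    have "x \<bullet> ((transpose B ** A ** B) *v x) = (B *v x) \<bullet> (A *v (B *v x))"
      by (simp add: inner_vector_matrix_mult flip: matrix_vector_mul_assoc)
    then show ?thesis using assms(1) inj[of x] that by (auto simp: spd_def)
  qed
  ultimately show ?thesis by (simp add: spd_def)
qed

lemma left_invertible_inj:
  fixes A B :: "real^'n^'n"
  assumes "B ** A = mat 1" "A *v x = 0"
  shows "x = 0"
proof -
  have "x = (B ** A) *v x" by (simp add: assms(1))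
  also have "\<dots> = B *v (A *v x)" by (rule matrix_vector_mul_assoc[symmetric])
  finally show ?thesis by (simp add: assms(2))
qed

lemma axis_mult_axis: "axis i 1 \<bullet> (A *v axis j 1) = A $ i $ j" for A :: "real^'n^'n"
  by (simp add: inner_axis' matrix_vector_mul_component inner_axis)

lemma spd_diag_pos: "spd A \<Longrightarrow> 0 < A $ i $ i"
  unfolding spd_def using axis_mult_axis[of i A i] by (metis axis_eq_0_iff zero_neq_one)

lemma spd_spectral:
  assumes "spd A"
  shows "\<exists>P e. orthogonal_matrix P \<and> A = P ** diag e ** transpose P \<and> (\<forall>i. 0 < e $ i)"
proof -
  have "transpose A = A" using assms by (simp add: spd_def)
  then obtain P e where P: "orthogonal_matrix P" and A: "A = P ** diag e ** transpose P"
    by (rule spectral_theorem)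
  have "spd (transpose P ** A ** P)"
    using assms left_invertible_inj P unfolding orthogonal_matrix_def by (blast intro: spd_congruence)
  moreover have "transpose P ** A ** P = diag e"
    unfolding A using P unfolding orthogonal_matrix_def
    by (simp add: matrix_mul_assoc[symmetric] matrix_cancel_left)
  ultimately have "0 < e $ i" for i using spd_diag_pos[of "diag e" i] by (simp add: diag_nth)
  with P A show ?thesis by blast
qed

lemma norm_square_trace: "norm X ^ 2 = trace (transpose X ** X)" for X :: "real^'n^'n"
  unfolding power2_norm_eq_inner inner_vec_def trace_def transpose_def matrix_matrix_mult_def
  by simp (rule sum.swap)

text \<open>
  Two positive definite forms are diagonal in a common basis: with \<open>S0\<^bsup>-1/2\<^esup> S1 S0\<^bsup>-1/2\<^esup> = U diag(w) U\<^sup>T\<close>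
  the change of basis is \<open>C = U\<^sup>T S0\<^bsup>1/2\<^esup>\<close>, with inverse \<open>B\<close>. Distance and geodesic then depend only
  on \<open>w\<close> and \<open>C\<close>, and the matrix powers in their definitions need not be mentioned again.
\<close>
lemma airm_simultaneous_diagonalisation:
  fixes S0 S1 :: "real^'n^'n"
  assumes "spd S0" "spd S1"
  shows "\<exists>(C :: real^'n^'n) (B :: real^'n^'n) w.
    C ** B = mat 1 \<and> B ** C = mat 1 \<and> (\<forall>i. 0 < w $ i) \<and>
    S0 = transpose C ** C \<and> S1 = transpose C ** diag w ** C \<and>
    d_airm S0 S1 = 1 / sqrt 2 * norm (\<chi> i. ln (w $ i)) \<and>
    (\<forall>t. airm_geodesic S0 S1 t = transpose C ** diag (\<chi> i. w $ i powr t) ** C)"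
proof -
  obtain P e where P: "orthogonal_matrix P" and S0: "S0 = P ** diag e ** transpose P"
    and e: "\<And>i. 0 < e $ i" using spd_spectral[OF assms(1)] by blast
  have P': "transpose P ** P = mat 1" "P ** transpose P = mat 1"
    using P by (auto simp: orthogonal_matrix_def)
  define R where "R = mat_powr S0 (1/2)"
  define Q where "Q = mat_powr S0 (-1/2)"
  have R: "R = P ** diag (\<chi> i. e $ i powr (1/2)) ** transpose P"
    and Q: "Q = P ** diag (\<chi> i. e $ i powr (-1/2)) ** transpose P"
    unfolding R_def Q_def mat_powr_def S0 by (rule mat_fun_diagonalised[OF P])+
  have mult: "(P ** diag a ** transpose P) ** (P ** diag b ** transpose P)
      = P ** diag (\<chi> i. a $ i * b $ i) ** transpose P" for a b
    by (simp add: matrix_mul_assoc[symmetric] matrix_cancel_left[OF P'(1)])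
      (simp add: matrix_mul_assoc diag_mult_diag)
  have one: "P ** diag (\<chi> i. 1) ** transpose P = mat 1"
    by (simp add: diag_one P')
  have RR: "R ** R = S0"
    unfolding R mult S0 using e by (simp add: less_imp_le flip: powr_add)
  have RQ: "R ** Q = mat 1" "Q ** R = mat 1"
    unfolding R Q mult using e by (simp_all add: one less_imp_neq[THEN not_sym] flip: powr_add)
  have tR: "transpose R = R" and tQ: "transpose Q = Q"
    unfolding R Q
    by (simp_all add: matrix_transpose_mul transpose_diag transpose_transpose matrix_mul_assoc)
  have "spd (transpose Q ** S1 ** Q)"
    using assms(2) left_invertible_inj[OF RQ(1)] by (rule spd_congruence)
  from spd_spectral[OF this] obtain U w where U: "orthogonal_matrix U" and W: "Q ** S1 ** Q = U ** diag w ** transpose U"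
    and w: "\<And>i. 0 < w $ i" unfolding tQ by blast
  have U': "transpose U ** U = mat 1" "U ** transpose U = mat 1"
    using U by (auto simp: orthogonal_matrix_def)
  define C where "C = transpose U ** R"
  define B where "B = Q ** U"
  have tC: "transpose C = R ** U"
    by (simp add: C_def matrix_transpose_mul tR transpose_transpose)
  have CB: "C ** B = mat 1" "B ** C = mat 1"
    unfolding C_def B_def
    by (simp_all add: matrix_mul_assoc[symmetric] matrix_cancel_left[OF RQ(1)]
        matrix_cancel_left[OF U'(2)] RQ U')
  have S0C: "S0 = transpose C ** C"
    unfolding tC unfolding C_def
    by (simp add: matrix_mul_assoc[symmetric] matrix_cancel_left[OF U'(2)] RR)
  have "R ** (Q ** S1 ** Q) ** R = (R ** Q) ** S1 ** (Q ** R)"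
    by (simp add: matrix_mul_assoc)
  then have S1C: "S1 = transpose C ** diag w ** C"
    unfolding tC W RQ unfolding C_def by (simp add: matrix_mul_assoc)
  have geo: "airm_geodesic S0 S1 t = transpose C ** diag (\<chi> i. w $ i powr t) ** C" for t
    unfolding airm_geodesic_def R_def[symmetric] Q_def[symmetric] W tC
    unfolding C_def mat_powr_def mat_fun_diagonalised[OF U] by (simp add: matrix_mul_assoc)
  have "norm (U ** diag a ** transpose U) = norm a" for a
  proof -
    have "norm (U ** diag a ** transpose U)^2
        = trace (U ** (diag a ** diag a ** transpose U))"
      unfolding norm_square_trace by (simp add: matrix_transpose_mul transpose_diag transpose_transpose
          matrix_mul_assoc[symmetric] matrix_cancel_left[OF U'(1)])
    also have "\<dots> = trace (diag a ** diag a ** (transpose U ** U))"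
      by (subst trace_mul_sym) (simp add: matrix_mul_assoc)
    also have "\<dots> = norm a ^ 2"
      by (simp add: U' diag_mult_diag trace_def diag_nth power2_norm_eq_inner inner_vec_def)
    finally show ?thesis by (rule power2_eq_imp_eq) simp_all
  qed
  then have "d_airm S0 S1 = 1 / sqrt 2 * norm (\<chi> i. ln (w $ i))"
    unfolding d_airm_def Q_def[symmetric] W mat_log_def mat_fun_diagonalised[OF U] by simp
  with CB w S0C S1C geo show ?thesis by blast
qed

section \<open>Gram--Schmidt pivots\<close>

text \<open>
  In an \<open>A\<close>-orthonormal frame \<open>Y\<close> one has \<open>A\<^sup>-\<^sup>1 = Y Y\<^sup>T\<close>, and the trace in the metric becomes a
  squared Frobenius norm.
\<close>
lemma airm_frame:
  fixes A X Y :: "real^'n^'n"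
  assumes Y: "transpose Y ** A ** Y = mat 1" and X: "transpose X = X"
  shows "airm A X X = 1/2 * norm (transpose Y ** X ** Y) ^ 2"
proof -
  have l: "(Y ** transpose Y) ** A = mat 1" and r: "A ** (Y ** transpose Y) = mat 1"
    using Y matrix_left_right_inverse[of "transpose Y ** A" Y]
      matrix_left_right_inverse[of "transpose Y" "A ** Y"]
    by (simp_all add: matrix_mul_assoc)
  have "A ** matrix_inv A = mat 1 \<and> matrix_inv A ** A = mat 1"
    unfolding matrix_inv_def using l r by (intro someI) blast
  then have "matrix_inv A ** (A ** (Y ** transpose Y)) = Y ** transpose Y"
    by (simp add: matrix_mul_assoc)
  then have inv: "matrix_inv A = Y ** transpose Y" by (simp add: r)
  define Z where "Z = transpose Y ** X ** Y"
  have Z: "transpose Z = Z"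
    by (simp add: Z_def matrix_transpose_mul transpose_transpose X matrix_mul_assoc)
  have "trace (matrix_inv A ** X ** matrix_inv A ** X)
      = trace (Y ** (transpose Y ** X ** Y ** transpose Y ** X))"
    by (simp add: inv matrix_mul_assoc)
  also have "\<dots> = trace (Z ** Z)"
    by (subst trace_mul_sym) (simp add: Z_def matrix_mul_assoc)
  also have "\<dots> = norm Z ^ 2" by (simp add: norm_square_trace Z)
  finally show ?thesis by (simp add: airm_def Z_def)
qed

text \<open>
  The unit vectors are orthogonalised with respect to the form \<open>A\<close>, in the order given by the
  ranking \<open>r\<close> of the coordinates. The ranking is a parameter because the equality case compares
  different orders.
\<close>
function gram_schmidt :: "('n::finite \<Rightarrow> nat) \<Rightarrow> real^'n^'n \<Rightarrow> 'n \<Rightarrow> real^'n" where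
  "gram_schmidt r A i = axis i 1 - (\<Sum>j | r j < r i.
     ((gram_schmidt r A j \<bullet> (A *v axis i 1)) / (gram_schmidt r A j \<bullet> (A *v gram_schmidt r A j)))
       *\<^sub>R gram_schmidt r A j)"
  by pat_completeness auto
termination by (relation "Wellfounded.measure (\<lambda>(r, A, i). r i)") auto

declare gram_schmidt.simps [simp del]

text \<open>
  The pivots are the entries of \<open>D\<close> in the factorisation \<open>A = L D L\<^sup>T\<close> with \<open>L\<close> unit triangular in
  the order \<open>r\<close>.
\<close>
definition pivot :: "('n::finite \<Rightarrow> nat) \<Rightarrow> real^'n^'n \<Rightarrow> 'n \<Rightarrow> real" where
  "pivot r A i = gram_schmidt r A i \<bullet> (A *v gram_schmidt r A i)"

lemma gram_schmidt_eq:
  "gram_schmidt r A i = axis i 1 - (\<Sum>j | r j < r i.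
     ((gram_schmidt r A j \<bullet> (A *v axis i 1)) / pivot r A j) *\<^sub>R gram_schmidt r A j)"
  by (subst gram_schmidt.simps) (simp add: pivot_def)

text \<open>
  Unit triangularity guarantees that the vectors do not vanish, whatever the form \<open>A\<close>.
\<close>
lemma gram_schmidt_triangular:
  "r i \<le> r k \<Longrightarrow> gram_schmidt r A i $ k = (if k = i then 1 else 0)"
proof (induction "r i" arbitrary: i rule: less_induct)
  case less
  have "gram_schmidt r A j $ k = 0" if "r j < r i" for j
    using less.hyps[OF that] less.prems that by auto
  then show ?case
    by (subst gram_schmidt_eq) (simp add: axis_def)
qed

lemma gram_schmidt_nonzero: "gram_schmidt r A i \<noteq> 0"
  using gram_schmidt_triangular[of r i i A] by auto

lemma pivot_pos: "spd A \<Longrightarrow> 0 < pivot r A i"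
  by (simp add: pivot_def spd_def gram_schmidt_nonzero)

lemma symmetric_inner_mult:
  "transpose A = A \<Longrightarrow> x \<bullet> (A *v y) = y \<bullet> (A *v x)" for A :: "real^'n^'n"
  using inner_vector_matrix_mult[of x y A] transpose_matrix_vector[of A y]
  by (simp add: inner_commute)

lemma gram_schmidt_orthogonal:
  assumes r: "inj r" and A: "spd A" and "r k < r i"
  shows "gram_schmidt r A k \<bullet> (A *v gram_schmidt r A i) = 0"
  using assms(3)
proof (induction "r i" arbitrary: i k rule: less_induct)
  case less
  let ?g = "gram_schmidt r A"
  have sym: "x \<bullet> (A *v y) = y \<bullet> (A *v x)" for x y
    using A by (intro symmetric_inner_mult) (simp add: spd_def)
  have zero: "?g j \<bullet> (A *v ?g k) = 0" if "r j < r i" "j \<noteq> k" for j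
  proof -
    have "r j < r k \<or> r k < r j" using r that by (metis injD linorder_neqE_nat)
    then show ?thesis
      using less.hyps[of k j] less.hyps[of j k] less.prems that sym[of "?g j" "?g k"] by auto
  qed
  have "?g i \<bullet> (A *v ?g k) = axis i 1 \<bullet> (A *v ?g k)
      - (\<Sum>j | r j < r i. ((?g j \<bullet> (A *v axis i 1)) / pivot r A j) * (?g j \<bullet> (A *v ?g k)))"
    by (subst gram_schmidt_eq) (simp add: inner_diff_left inner_sum_left)
  also have "(\<Sum>j | r j < r i. ((?g j \<bullet> (A *v axis i 1)) / pivot r A j) * (?g j \<bullet> (A *v ?g k)))
      = (\<Sum>j | r j < r i. if j = k then ?g k \<bullet> (A *v axis i 1) else 0)"
    using pivot_pos[OF A, of r k] zero
    by (intro sum.cong) (auto simp: pivot_def)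
  also have "\<dots> = ?g k \<bullet> (A *v axis i 1)"
    using less.prems by (subst sum.delta) auto
  finally show ?case using sym[of "?g i" "?g k"] sym[of "?g k" "axis i 1"] by simp
qed

lemma gram_schmidt_frame:
  assumes r: "inj r" and A: "spd A"
  defines "Y \<equiv> (\<chi> k i. gram_schmidt r A i $ k / sqrt (pivot r A i)) :: real^'n^'n"
  shows "transpose Y ** A ** Y = mat 1"
    and "(transpose Y ** X ** Y) $ i $ j
      = gram_schmidt r A i \<bullet> (X *v gram_schmidt r A j) / (sqrt (pivot r A i) * sqrt (pivot r A j))"
proof -
  have col: "Y *v axis i 1 = (1 / sqrt (pivot r A i)) *\<^sub>R gram_schmidt r A i" for i
    by (simp add: Y_def matrix_vector_mul_component matrix_vector_mult_basis column_def vec_eq_iff)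
  have entry: "(transpose Y ** X ** Y) $ i $ j
      = gram_schmidt r A i \<bullet> (X *v gram_schmidt r A j) / (sqrt (pivot r A i) * sqrt (pivot r A j))"
    for X :: "real^'n^'n" and i j
  proof -
    have "(transpose Y ** X ** Y) $ i $ j = axis i 1 \<bullet> ((transpose Y ** X ** Y) *v axis j 1)"
      by (rule axis_mult_axis[symmetric])
    also have "\<dots> = (Y *v axis i 1) \<bullet> (X *v (Y *v axis j 1))"
      by (simp add: inner_vector_matrix_mult flip: matrix_vector_mul_assoc)
    finally show ?thesis by (simp add: col matrix_vector_mult_scaleR)
  qed
  show "(transpose Y ** X ** Y) $ i $ j
      = gram_schmidt r A i \<bullet> (X *v gram_schmidt r A j) / (sqrt (pivot r A i) * sqrt (pivot r A j))"
    by (rule entry)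
  have "(transpose Y ** A ** Y) $ i $ j = mat 1 $ i $ j" for i j
  proof (cases "i = j")
    case True
    then show ?thesis
      using pivot_pos[OF A, of r j] unfolding entry by (simp add: mat_def pivot_def[symmetric])
  next
    case False
    then have "r i < r j \<or> r j < r i" using r by (metis injD linorder_neqE_nat)
    moreover have "gram_schmidt r A i \<bullet> (A *v gram_schmidt r A j)
        = gram_schmidt r A j \<bullet> (A *v gram_schmidt r A i)"
      using A by (intro symmetric_inner_mult) (simp add: spd_def)
    ultimately have "gram_schmidt r A i \<bullet> (A *v gram_schmidt r A j) = 0"
      using gram_schmidt_orthogonal[OF r A] by metis
    then show ?thesis using False unfolding entry by (simp add: mat_def)
  qed
  then show "transpose Y ** A ** Y = mat 1" by (simp add: vec_eq_iff)
qed

lemma airm_gram_schmidt: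
  fixes A X :: "real^'n^'n"
  assumes r: "inj r" and A: "spd A" and X: "transpose X = X"
  shows "airm A X X = 1/2 * (\<Sum>i\<in>UNIV. \<Sum>j\<in>UNIV.
    (gram_schmidt r A i \<bullet> (X *v gram_schmidt r A j))\<^sup>2 / (pivot r A i * pivot r A j))"
proof -
  have "norm Z ^ 2 = (\<Sum>i\<in>UNIV. \<Sum>j\<in>UNIV. (Z $ i $ j)\<^sup>2)" for Z :: "real^'n^'n"
    unfolding power2_norm_eq_inner inner_vec_def by (simp add: power2_eq_square)
  then show ?thesis
    using pivot_pos[OF A, of r]
    by (simp add: airm_frame[OF gram_schmidt_frame(1)[OF r A] X] gram_schmidt_frame(2)[OF r A]
        power_divide power_mult_distrib less_imp_le)
qed

lemma ex_ranking: "\<exists>r :: 'n::finite \<Rightarrow> nat. inj r"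
  by (metis finite finite_imp_inj_to_nat_seg)

text \<open>
  If \<open>Y\<close> is an orthonormal frame for \<open>B\<^sup>T A B\<close>, then \<open>B Y\<close> is one for \<open>A\<close>, and both frames express the
  tangent vectors by the same matrix.
\<close>
lemma airm_congruence:
  fixes A B X :: "real^'n^'n"
  assumes A: "spd (transpose B ** A ** B)" and X: "transpose X = X"
  shows "airm (transpose B ** A ** B) (transpose B ** X ** B) (transpose B ** X ** B) = airm A X X"
proof -
  obtain r :: "'n \<Rightarrow> nat" where r: "inj r" using ex_ranking by blast
  have "\<exists>Y :: real^'n^'n. transpose Y ** (transpose B ** A ** B) ** Y = mat 1"
    using gram_schmidt_frame(1)[OF r A] by (rule exI)
  then obtain Y :: "real^'n^'n" where Y: "transpose Y ** (transpose B ** A ** B) ** Y = mat 1" ..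
  have Y': "transpose (B ** Y) ** A ** (B ** Y) = mat 1"
    using Y by (simp add: matrix_transpose_mul matrix_mul_assoc)
  have X': "transpose (transpose B ** X ** B) = transpose B ** X ** B"
    by (simp add: matrix_transpose_mul transpose_transpose X matrix_mul_assoc)
  show ?thesis
    unfolding airm_frame[OF Y X'] airm_frame[OF Y' X]
    by (simp add: matrix_transpose_mul matrix_mul_assoc)
qed

lemma bounded_bilinear_matrix_vector_mult:
  "bounded_bilinear ((*v) :: real^'n^'m \<Rightarrow> real^'n \<Rightarrow> real^'m)"
proof (subst bilinear_conv_bounded_bilinear[symmetric])
  show "bilinear ((*v) :: real^'n^'m \<Rightarrow> real^'n \<Rightarrow> real^'m)"
    unfolding bilinear_def
    by (auto intro!: linearI simp: matrix_vector_right_distrib matrix_vector_mult_add_rdistrib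
        matrix_vector_mult_scaleR scaleR_matrix_vector_assoc)
qed

lemmas has_vector_derivative_matrix_vector_mult =
  bounded_bilinear.has_vector_derivative[OF bounded_bilinear_matrix_vector_mult]

lemmas has_vector_derivative_inner =
  bounded_bilinear.has_vector_derivative[OF bounded_bilinear_inner]

text \<open>
  The leading coefficient of a Gram--Schmidt vector is constant, so its derivative involves only
  the earlier vectors, to which the vector itself is orthogonal.
\<close>
lemma gram_schmidt_derivative:
  assumes A: "\<And>j. pivot r (T t) j \<noteq> 0" and T: "(T has_vector_derivative T') (at t within S)"
  shows "\<exists>d \<in> span (gram_schmidt r (T t) ` {j. r j < r i}).
    ((\<lambda>s. gram_schmidt r (T s) i) has_vector_derivative d) (at t within S)"
proof (induction "r i" arbitrary: i rule: less_induct)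
  case less
  let ?g = "\<lambda>s. gram_schmidt r (T s)"
  let ?V = "span (?g t ` {j. r j < r i})"
  have "\<exists>d\<in>?V. ((\<lambda>s. ((?g s j \<bullet> (T s *v axis i 1)) / pivot r (T s) j) *\<^sub>R ?g s j)
      has_vector_derivative d) (at t within S)" if j: "r j < r i" for j
  proof -
    obtain d where d: "d \<in> span (?g t ` {k. r k < r j})"
      "((\<lambda>s. ?g s j) has_vector_derivative d) (at t within S)" using less[OF j] by blast
    have "span (?g t ` {k. r k < r j}) \<subseteq> ?V"
      using j by (intro span_mono image_mono) auto
    then have dV: "d \<in> ?V" using d(1) by blast
    have gV: "?g t j \<in> ?V" using j by (intro span_base) auto
    obtain a where a: "((\<lambda>s. ?g s j \<bullet> (T s *v axis i 1)) has_vector_derivative a) (at t within S)"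
      using has_vector_derivative_inner[OF d(2)
          has_vector_derivative_matrix_vector_mult[OF T has_vector_derivative_const]] by blast
    obtain b where b: "((\<lambda>s. pivot r (T s) j) has_vector_derivative b) (at t within S)"
      using has_vector_derivative_inner[OF d(2)
          has_vector_derivative_matrix_vector_mult[OF T d(2)]]
      unfolding pivot_def by blast
    obtain c where c: "((\<lambda>s. (?g s j \<bullet> (T s *v axis i 1)) / pivot r (T s) j)
        has_vector_derivative c) (at t within S)"
      using DERIV_divide[OF a[folded has_real_derivative_iff_has_vector_derivative]
          b[folded has_real_derivative_iff_has_vector_derivative] A]
      unfolding has_real_derivative_iff_has_vector_derivative by blast
    show ?thesis
      using has_vector_derivative_scaleR[OF c[folded has_real_derivative_iff_has_vector_derivative] d(2)]
      by (rule bexI) (intro span_add span_scale dV gV)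
  qed
  then have "\<forall>j\<in>{j. r j < r i}. \<exists>d. d \<in> ?V \<and>
    ((\<lambda>s. ((?g s j \<bullet> (T s *v axis i 1)) / pivot r (T s) j) *\<^sub>R ?g s j)
      has_vector_derivative d) (at t within S)" by blast
  from bchoice[OF this] obtain D where D: "\<And>j. r j < r i \<Longrightarrow> D j \<in> ?V"
    "\<And>j. r j < r i \<Longrightarrow> ((\<lambda>s. ((?g s j \<bullet> (T s *v axis i 1)) / pivot r (T s) j) *\<^sub>R ?g s j)
      has_vector_derivative D j) (at t within S)"
    by blast
  have "((\<lambda>s. axis i 1 - (\<Sum>j | r j < r i.
      ((?g s j \<bullet> (T s *v axis i 1)) / pivot r (T s) j) *\<^sub>R ?g s j))
      has_vector_derivative 0 - (\<Sum>j | r j < r i. D j)) (at t within S)"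
    by (intro has_vector_derivative_diff has_vector_derivative_const has_vector_derivative_sum D(2))
       simp
  then have "((\<lambda>s. ?g s i) has_vector_derivative 0 - (\<Sum>j | r j < r i. D j)) (at t within S)"
    by (subst (asm) gram_schmidt_eq[symmetric])
  moreover have "0 - (\<Sum>j | r j < r i. D j) \<in> ?V"
    by (intro span_diff span_zero span_sum D(1)) simp
  ultimately show ?case by blast
qed

text \<open>
  Only the derivative of the form contributes: the derivative of the vector is orthogonal to the vector.
\<close>
lemma pivot_derivative:
  assumes r: "inj r" and A: "spd (T t)" and T: "(T has_vector_derivative T') (at t within S)"
  shows "((\<lambda>s. pivot r (T s) i) has_real_derivative
    gram_schmidt r (T t) i \<bullet> (T' *v gram_schmidt r (T t) i)) (at t within S)"
proof -
  let ?g = "\<lambda>s. gram_schmidt r (T s)"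
  have "pivot r (T t) j \<noteq> 0" for j using pivot_pos[OF A, of r j] by simp
  then obtain d where d: "d \<in> span (?g t ` {j. r j < r i})"
    "((\<lambda>s. ?g s i) has_vector_derivative d) (at t within S)"
    using gram_schmidt_derivative[OF _ T] by blast
  have orth: "d \<bullet> (T t *v ?g t i) = 0"
    using d(1)
  proof (induction rule: span_induct_alt)
    case (step c x y)
    then show ?case using gram_schmidt_orthogonal[OF r A] by (auto simp: inner_add_left)
  qed simp
  have sym: "?g t i \<bullet> (T t *v d) = d \<bullet> (T t *v ?g t i)"
    using A by (intro symmetric_inner_mult) (simp add: spd_def)
  show ?thesis
    using has_vector_derivative_inner[OF d(2) has_vector_derivative_matrix_vector_mult[OF T d(2)]]
    unfolding has_real_derivative_iff_has_vector_derivative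
    by (simp add: pivot_def orth sym inner_add_right)
qed

lemma gram_schmidt_continuous:
  assumes "\<And>t. t \<in> S \<Longrightarrow> spd (T t)" "\<And>t. t \<in> S \<Longrightarrow> (T has_vector_derivative T' t) (at t within S)"
  shows "continuous_on S (\<lambda>t. gram_schmidt r (T t) i)"
proof -
  have "continuous (at t within S) (\<lambda>t. gram_schmidt r (T t) i)" if t: "t \<in> S" for t
  proof -
    have "pivot r (T t) j \<noteq> 0" for j using pivot_pos[OF assms(1)[OF t], of r j] by simp
    from gram_schmidt_derivative[where i = i, OF this assms(2)[OF t]]
    show ?thesis using has_vector_derivative_continuous by blast
  qed
  then show ?thesis by (simp add: continuous_on_eq_continuous_within)
qed


section \<open>Lengths of paths of positive definite matrices\<close>

lemma has_derivative_vec: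
  fixes f :: "'a::real_normed_vector \<Rightarrow> 'b::real_normed_vector^'n"
  assumes "\<And>i. ((\<lambda>x. f x $ i) has_derivative (\<lambda>h. f' h $ i)) (at x within S)"
  shows "(f has_derivative f') (at x within S)"
proof -
  have bl: "bounded_linear (\<lambda>h. f' h $ i)" for i using assms by (rule has_derivative_bounded_linear)
  have lim: "((\<lambda>y. (1 / norm (y - x)) *\<^sub>R (f y - (f x + f' (y - x)))) \<longlongrightarrow> 0) (at x within S)"
    using assms unfolding has_derivative_within by (intro vec_tendstoI) simp
  have "linear f'"
    by (intro linearI) (simp_all add: vec_eq_iff linear_add[OF bounded_linear.linear[OF bl]]
        linear_scale[OF bounded_linear.linear[OF bl]])
  moreover have "\<exists>K. \<forall>h. norm (f' h) \<le> norm h * K"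
  proof -
    have "\<forall>i. \<exists>K. \<forall>h. norm (f' h $ i) \<le> norm h * K" using bounded_linear.bounded[OF bl] by blast
    from choice[OF this] obtain K where K: "\<And>i h. norm (f' h $ i) \<le> norm h * K i" by blast
    have "norm (f' h) \<le> norm h * (\<Sum>i\<in>UNIV. K i)" for h
    proof -
      have "norm (f' h) \<le> (\<Sum>i\<in>UNIV. norm (f' h $ i))"
        unfolding norm_vec_def by (rule L2_set_le_sum) simp
      also have "\<dots> \<le> (\<Sum>i\<in>UNIV. norm h * K i)" by (intro sum_mono K)
      finally show ?thesis by (simp add: sum_distrib_left)
    qed
    then show ?thesis by blast
  qed
  ultimately have "bounded_linear f'"
    by (simp add: bounded_linear_def bounded_linear_axioms_def)
  with lim show ?thesis by (simp add: has_derivative_within)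
qed

lemma has_vector_derivative_vec:
  fixes f :: "real \<Rightarrow> 'a::real_normed_vector^'n"
  assumes "\<And>i. ((\<lambda>t. f t $ i) has_vector_derivative f' $ i) (at t within S)"
  shows "(f has_vector_derivative f') (at t within S)"
  using assms unfolding has_vector_derivative_def by (intro has_derivative_vec) simp

definition log_pivots :: "('n::finite \<Rightarrow> nat) \<Rightarrow> real^'n^'n \<Rightarrow> real^'n" where
  "log_pivots r A = (\<chi> i. ln (pivot r A i))"

text \<open>
  The derivative is carried along as \<open>T'\<close> since speeds and lengths are computed from it.
\<close>
definition spd_path :: "(real \<Rightarrow> real^'n^'n) \<Rightarrow> (real \<Rightarrow> real^'n^'n) \<Rightarrow> bool" where
  "spd_path T T' \<longleftrightarrow> continuous_on {0..1} T' \<and> (\<forall>t\<in>{0..1}. spd (T t) \<and>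
     transpose (T' t) = T' t \<and> (T has_vector_derivative T' t) (at t within {0..1}))"

definition airm_speed :: "(real \<Rightarrow> real^'n^'n) \<Rightarrow> (real \<Rightarrow> real^'n^'n) \<Rightarrow> real \<Rightarrow> real" where
  "airm_speed T T' t = sqrt (airm (T t) (T' t) (T' t))"

lemma airm_speed_continuous:
  fixes T :: "real \<Rightarrow> real^'n^'n"
  assumes "spd_path T T'"
  shows "continuous_on {0..1} (airm_speed T T')"
proof -
  obtain r :: "'n \<Rightarrow> nat" where r: "inj r" using ex_ranking by blast
  have spd: "spd (T t)" and sym: "transpose (T' t) = T' t"
    and der: "(T has_vector_derivative T' t) (at t within {0..1})" if "t \<in> {0..1}" for t
    using assms that by (auto simp: spd_path_def)
  have T': "continuous_on {0..1} T'" using assms by (simp add: spd_path_def)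
  have T: "continuous_on {0..1} T"
    using has_vector_derivative_continuous[OF der] by (simp add: continuous_on_eq_continuous_within)
  note [continuous_intros] = gram_schmidt_continuous[OF spd der]
    bounded_bilinear.continuous_on[OF bounded_bilinear_matrix_vector_mult]
  have piv: "continuous_on {0..1} (\<lambda>t. pivot r (T t) i)" for i
    unfolding pivot_def by (intro continuous_intros T) auto
  have "continuous_on {0..1} (\<lambda>t. sqrt (1/2 * (\<Sum>i\<in>UNIV. \<Sum>j\<in>UNIV.
    (gram_schmidt r (T t) i \<bullet> (T' t *v gram_schmidt r (T t) j))\<^sup>2 / (pivot r (T t) i * pivot r (T t) j))))"
    by (intro continuous_intros piv T') (auto dest!: spd simp: pivot_pos less_imp_neq[THEN not_sym])
  then show ?thesis
    by (rule continuous_on_eq) (simp add: airm_speed_def airm_gram_schmidt[OF r spd sym])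
qed

lemma norm_vec_square: "norm x ^ 2 = (\<Sum>i\<in>UNIV. (x $ i)\<^sup>2)" for x :: "real^'n"
  unfolding power2_norm_eq_inner inner_vec_def by (simp add: power2_eq_square)

text \<open>
  The left-hand side is the norm of the derivative of the log-pivots in the direction \<open>X\<close>. It collects
  the diagonal of the matrix of \<open>X\<close> in the Gram--Schmidt frame; the right-hand side is the
  Frobenius norm of the whole matrix.
\<close>
lemma norm_log_pivots_derivative_le:
  fixes A X :: "real^'n^'n"
  assumes r: "inj r" and A: "spd A" and X: "transpose X = X"
  shows "norm (\<chi> i. (gram_schmidt r A i \<bullet> (X *v gram_schmidt r A i)) / pivot r A i)
    \<le> sqrt 2 * sqrt (airm A X X)"
proof -
  let ?g = "gram_schmidt r A"
  have pos: "0 < pivot r A i" for i by (rule pivot_pos[OF A])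
  have "norm (\<chi> i. (?g i \<bullet> (X *v ?g i)) / pivot r A i) ^ 2
      = (\<Sum>i\<in>UNIV. (?g i \<bullet> (X *v ?g i))\<^sup>2 / (pivot r A i * pivot r A i))"
    by (simp add: norm_vec_square power_divide power2_eq_square[of "pivot r A _"])
  also have "\<dots> \<le> (\<Sum>i\<in>UNIV. \<Sum>j\<in>UNIV. (?g i \<bullet> (X *v ?g j))\<^sup>2 / (pivot r A i * pivot r A j))"
    using pos by (intro sum_mono member_le_sum) (auto simp: less_imp_le)
  also have "\<dots> = 2 * airm A X X" by (simp add: airm_gram_schmidt[OF r A X])
  finally show ?thesis
    by (metis norm_ge_zero real_le_rsqrt real_sqrt_mult)
qed

lemma log_pivots_increment_le:
  fixes T :: "real \<Rightarrow> real^'n^'n"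
  assumes T: "spd_path T T'" and r: "inj r" and ab: "0 \<le> a" "a \<le> b" "b \<le> 1"
  shows "norm (log_pivots r (T b) - log_pivots r (T a)) \<le> sqrt 2 * integral {a..b} (airm_speed T T')"
proof -
  let ?d = "\<lambda>t. (\<chi> i. (gram_schmidt r (T t) i \<bullet> (T' t *v gram_schmidt r (T t) i)) / pivot r (T t) i)"
  have spd: "spd (T t)" and sym: "transpose (T' t) = T' t"
    and der: "(T has_vector_derivative T' t) (at t within {0..1})" if "t \<in> {0..1}" for t
    using T that by (auto simp: spd_path_def)
  have "((\<lambda>t. log_pivots r (T t)) has_vector_derivative ?d t) (at t within {a..b})"
    if "t \<in> {a..b}" for t
  proof (rule has_vector_derivative_within_subset)
    have t: "t \<in> {0..1}" using that ab by auto
    show "((\<lambda>t. log_pivots r (T t)) has_vector_derivative ?d t) (at t within {0..1})"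
    proof (rule has_vector_derivative_vec)
      fix i
      show "((\<lambda>t. log_pivots r (T t) $ i) has_vector_derivative ?d t $ i) (at t within {0..1})"
        using pivot_derivative[OF r spd[OF t] der[OF t], of i] pivot_pos[OF spd[OF t], of r i]
        unfolding has_real_derivative_iff_has_vector_derivative[symmetric] log_pivots_def
        by (auto intro!: derivative_eq_intros)
    qed
  qed (use ab in auto)
  then have int: "(?d has_integral (log_pivots r (T b) - log_pivots r (T a))) {a..b}"
    using ab by (intro fundamental_theorem_of_calculus)
  have speed: "airm_speed T T' integrable_on {a..b}"
    using ab by (intro integrable_continuous_interval continuous_on_subset[OF airm_speed_continuous[OF T]]) auto
  have "norm (integral {a..b} ?d) \<le> integral {a..b} (\<lambda>t. sqrt 2 * airm_speed T T' t)"
  proof (rule integral_norm_bound_integral)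
    show "?d integrable_on {a..b}" using int by blast
    show "(\<lambda>t. sqrt 2 * airm_speed T T' t) integrable_on {a..b}"
      using speed by (rule integrable_on_mult_right)
    fix t assume "t \<in> {a..b}"
    then have t: "t \<in> {0..1}" using ab by auto
    show "norm (?d t) \<le> sqrt 2 * airm_speed T T' t"
      unfolding airm_speed_def by (rule norm_log_pivots_derivative_le[OF r spd[OF t] sym[OF t]])
  qed
  then show ?thesis using integral_unique[OF int] by simp
qed

lemma airm_speed_nonneg:
  fixes T :: "real \<Rightarrow> real^'n^'n"
  assumes "spd_path T T'" "t \<in> {0..1}"
  shows "0 \<le> airm_speed T T' t"
proof -
  obtain r :: "'n \<Rightarrow> nat" where r: "inj r" using ex_ranking by blast
  have "0 \<le> sqrt 2 * airm_speed T T' t"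
    unfolding airm_speed_def using assms
    by (intro order_trans[OF norm_ge_zero norm_log_pivots_derivative_le[OF r]])
       (auto simp: spd_path_def)
  then show ?thesis by (simp add: zero_le_mult_iff)
qed

lemma ex_half_length:
  fixes g :: "real \<Rightarrow> real"
  assumes g: "continuous_on {0..1} g" and nonneg: "0 \<le> integral {0..1} g"
  shows "\<exists>s\<in>{0..1}. integral {0..s} g = integral {0..1} g / 2 \<and> integral {s..1} g = integral {0..1} g / 2"
proof -
  have int: "g integrable_on {0..1}" using g by (rule integrable_continuous_interval)
  then have "continuous_on {0..1} (\<lambda>s. integral {0..s} g)" by (rule indefinite_integral_continuous_1)
  then obtain s where s: "0 \<le> s" "s \<le> 1" "integral {0..s} g = integral {0..1} g / 2"
    using IVT'[of "\<lambda>s. integral {0..s} g" 0 "integral {0..1} g / 2" 1] nonneg by auto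
  then have "integral {0..s} g + integral {s..1} g = integral {0..1} g"
    using Henstock_Kurzweil_Integration.integral_combine[OF s(1,2) int] by simp
  with s show ?thesis by auto
qed

lemma gram_schmidt_diag: "gram_schmidt r (diag w) i = axis i 1"
proof (induction "r i" arbitrary: i rule: less_induct)
  case less
  have "(gram_schmidt r (diag w) j \<bullet> (diag w *v axis i 1)) = 0" if "r j < r i" for j
    using less[OF that] that by (auto simp: axis_mult_axis diag_nth)
  then show ?case by (subst gram_schmidt_eq) simp
qed

lemma log_pivots_diag: "log_pivots r (diag w) = (\<chi> i. ln (w $ i))"
  by (simp add: log_pivots_def pivot_def gram_schmidt_diag axis_mult_axis diag_nth)

text \<open>
  At half of the length the log-pivots are within \<open>len/\<surd>2\<close> of \<open>0\<close> and of \<open>ln w\<close>. These two points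
  are at distance \<open>\<surd>2 d\<close>, so by the parallelogram law the log-pivots are close to the midpoint of the
  two if \<open>len\<close> is close to \<open>d\<close>. The point \<open>s\<close> depends only on the path and serves all orders
  of the coordinates simultaneously.
\<close>
lemma log_pivots_midpoint:
  fixes T :: "real \<Rightarrow> real^'n^'n"
  assumes T: "spd_path T T'" and T0: "T 0 = mat 1" and T1: "T 1 = diag w"
  defines "len \<equiv> integral {0..1} (airm_speed T T')" and "d \<equiv> 1 / sqrt 2 * norm (\<chi> i. ln (w $ i))"
  shows "\<exists>s\<in>{0..1}. \<forall>r. inj r \<longrightarrow>
    norm (log_pivots r (T s) - (1/2) *\<^sub>R (\<chi> i. ln (w $ i))) ^ 2 \<le> (len\<^sup>2 - d\<^sup>2) / 2"
proof -
  let ?m = "\<chi> i. ln (w $ i)"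
  have start: "log_pivots r (T 0) = 0" for r
    using log_pivots_diag[of r "\<chi> i. 1"] by (simp add: T0 diag_one vec_eq_iff)
  have "0 \<le> len" unfolding len_def
    using airm_speed_nonneg[OF T]
    by (intro Henstock_Kurzweil_Integration.integral_nonneg integrable_continuous_interval airm_speed_continuous[OF T]) auto
  then obtain s where s: "s \<in> {0..1}" "integral {0..s} (airm_speed T T') = len / 2"
    "integral {s..1} (airm_speed T T') = len / 2"
    using ex_half_length[OF airm_speed_continuous[OF T]] unfolding len_def by blast
  have "norm (log_pivots r (T s) - (1/2) *\<^sub>R ?m) ^ 2 \<le> (len\<^sup>2 - d\<^sup>2) / 2" if r: "inj r" for r
  proof -
    let ?x = "log_pivots r (T s)"
    have x: "norm ?x \<le> sqrt 2 * (len / 2)"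
      using log_pivots_increment_le[OF T r, of 0 s] s by (simp add: start)
    have y: "norm (?m - ?x) \<le> sqrt 2 * (len / 2)"
      using log_pivots_increment_le[OF T r, of s 1] s by (simp add: T1 log_pivots_diag)
    have "norm (?x - (1/2) *\<^sub>R ?m) ^ 2
        = (norm ?x ^ 2 + norm (?m - ?x) ^ 2) / 2 - norm ?m ^ 2 / 4"
      by (simp add: power2_norm_eq_inner inner_diff_left inner_diff_right inner_commute field_simps)
    also have "\<dots> \<le> ((sqrt 2 * (len / 2))\<^sup>2 + (sqrt 2 * (len / 2))\<^sup>2) / 2 - norm ?m ^ 2 / 4"
      using power_mono[OF x, of 2] power_mono[OF y, of 2] by simp
    also have "\<dots> = (len\<^sup>2 - d\<^sup>2) / 2"
      by (simp add: d_def power_mult_distrib power_divide field_simps)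
    finally show ?thesis .
  qed
  with s show ?thesis by blast
qed


section \<open>Paths with a fixed diagonal entry\<close>

lemma pivot_first:
  assumes "{j. r j < r i} = {}"
  shows "pivot r A i = A $ i $ i"
  unfolding pivot_def by (subst (1 2) gram_schmidt_eq) (simp add: assms axis_mult_axis)

text \<open>
  The second pivot is the Schur complement \<open>A\<^sub>j\<^sub>j - A\<^sub>i\<^sub>j\<^sup>2 / A\<^sub>i\<^sub>i\<close>, so off-diagonal entries can be read off
  from pivots.
\<close>
lemma pivot_second:
  assumes r: "inj r" and A: "spd A" and i: "{k. r k < r i} = {}" and j: "{k. r k < r j} = {i}"
  shows "(A $ i $ j)\<^sup>2 = A $ i $ i * (A $ j $ j - pivot r A j)"
proof -
  have gi: "gram_schmidt r A i = axis i 1" by (subst gram_schmidt_eq) (simp add: i)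
  have gj: "gram_schmidt r A j = axis j 1 - (A $ i $ j / A $ i $ i) *\<^sub>R axis i 1"
    by (subst gram_schmidt_eq) (simp add: j gi pivot_def axis_mult_axis)
  have "transpose A $ i $ j = A $ i $ j" using A by (simp add: spd_def)
  then have sym: "A $ j $ i = A $ i $ j" by (simp add: transpose_def)
  have "pivot r A j = A $ j $ j - (A $ i $ j)\<^sup>2 / A $ i $ i"
    using spd_diag_pos[OF A, of i] unfolding pivot_def gj
    by (simp add: inner_diff_left inner_diff_right matrix_vector_mult_diff_distrib
        matrix_vector_mult_scaleR axis_mult_axis sym power2_eq_square)
  then show ?thesis using spd_diag_pos[OF A, of i] by (simp add: field_simps)
qed

lemma ex_ranking_starting_with:
  fixes i j :: "'n::finite"
  assumes "i \<noteq> j"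
  shows "\<exists>r :: 'n \<Rightarrow> nat. inj r \<and> {k. r k < r i} = {} \<and> {k. r k < r j} = {i}"
proof -
  obtain r0 :: "'n \<Rightarrow> nat" where r0: "inj r0" using ex_ranking by blast
  define r where "r k = (if k = i then 0 else if k = j then 1 else r0 k + 2)" for k
  have "inj r" using r0 by (auto simp: inj_def r_def split: if_splits)
  moreover have "{k. r k < r i} = {}" "{k. r k < r j} = {i}"
    using assms by (auto simp: r_def split: if_splits)
  ultimately show ?thesis by blast
qed

lemma ex_ranking_first:
  "\<exists>r :: 'n::finite \<Rightarrow> nat. inj r \<and> {k. r k < r i} = {}"
proof -
  obtain r0 :: "'n \<Rightarrow> nat" where r0: "inj r0" using ex_ranking by blast
  define r where "r k = (if k = i then 0 else Suc (r0 k))" for k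
  have "inj r" using r0 by (auto simp: inj_def r_def split: if_splits)
  moreover have "{k. r k < r i} = {}" by (auto simp: r_def)
  ultimately show ?thesis by blast
qed

lemma tendsto_zero_if_square:
  fixes f :: "'a \<Rightarrow> real"
  assumes "((\<lambda>x. (f x)\<^sup>2) \<longlongrightarrow> 0) F"
  shows "(f \<longlongrightarrow> 0) F"
  using tendsto_real_sqrt[OF assms] by (simp add: tendsto_rabs_zero_iff)

text \<open>
  A diagonal entry is a first pivot in a suitable order. If first and second pivots at \<open>j\<close> have the same
  limit, then the Schur complement formula forces the off-diagonal entries to \<open>0\<close>.
\<close>
lemma tendsto_diag_if_pivots_tendsto:
  fixes X :: "nat \<Rightarrow> real^'n^'n"
  assumes X: "\<And>n. spd (X n)"
    and piv: "\<And>r i. inj r \<Longrightarrow> (\<lambda>n. pivot r (X n) i) \<longlonglongrightarrow> v $ i"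
  shows "X \<longlonglongrightarrow> diag v"
proof (rule vec_tendstoI, rule vec_tendstoI)
  fix i j
  have dg: "(\<lambda>n. X n $ k $ k) \<longlonglongrightarrow> v $ k" for k
  proof -
    obtain r :: "'n \<Rightarrow> nat" where "inj r" "{l. r l < r k} = {}" using ex_ranking_first by metis
    then show ?thesis using piv[of r k] by (simp add: pivot_first)
  qed
  show "(\<lambda>n. X n $ i $ j) \<longlonglongrightarrow> diag v $ i $ j"
  proof (cases "i = j")
    case True then show ?thesis using dg by (simp add: diag_nth)
  next
    case False
    obtain r :: "'n \<Rightarrow> nat" where r: "inj r" "{k. r k < r i} = {}" "{k. r k < r j} = {i}"
      using ex_ranking_starting_with[OF False] by blast
    have "(\<lambda>n. X n $ i $ i * (X n $ j $ j - pivot r (X n) j)) \<longlonglongrightarrow> v $ i * (v $ j - v $ j)"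
      by (intro tendsto_intros dg piv r)
    then have "(\<lambda>n. (X n $ i $ j)\<^sup>2) \<longlonglongrightarrow> 0"
      using pivot_second[OF r(1) X r(2,3)] by simp
    then have "(\<lambda>n. X n $ i $ j) \<longlonglongrightarrow> 0" by (rule tendsto_zero_if_square)
    then show ?thesis using False by (simp add: diag_nth)
  qed
qed

lemma diag_mult_vec_nth: "(diag w *v c) $ i = w $ i * c $ i"
  by (simp add: matrix_vector_mult_def diag_nth if_distrib[of "\<lambda>x. x * _"] cong: if_cong)

text \<open>
  The three sums combine to \<open>\<Sum>\<^sub>i c\<^sub>i\<^sup>2 (\<surd>w\<^sub>i - 1)\<^sup>2 = 0\<close>, so \<open>w\<^sub>i = 1\<close> wherever \<open>c\<^sub>i \<noteq> 0\<close>.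
\<close>
lemma column_fixed_by_diag:
  fixes w c :: "real^'n"
  assumes w: "\<And>i. 0 < w $ i"
    and sums: "(\<Sum>i\<in>UNIV. (c $ i)\<^sup>2) = 1" "(\<Sum>i\<in>UNIV. (c $ i)\<^sup>2 * sqrt (w $ i)) = 1"
      "(\<Sum>i\<in>UNIV. (c $ i)\<^sup>2 * w $ i) = 1"
  shows "diag w *v c = c"
proof -
  have "(\<Sum>i\<in>UNIV. (c $ i * (sqrt (w $ i) - 1))\<^sup>2)
      = (\<Sum>i\<in>UNIV. (c $ i)\<^sup>2 * w $ i - 2 * ((c $ i)\<^sup>2 * sqrt (w $ i)) + (c $ i)\<^sup>2)"
  proof (rule sum.cong)
    fix i
    have "(sqrt (w $ i))\<^sup>2 = w $ i" using w[of i] by simp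
    then show "(c $ i * (sqrt (w $ i) - 1))\<^sup>2
        = (c $ i)\<^sup>2 * w $ i - 2 * ((c $ i)\<^sup>2 * sqrt (w $ i)) + (c $ i)\<^sup>2"
      by (simp add: power_mult_distrib power2_diff algebra_simps) (simp add: power2_eq_square)
  qed simp
  also have "\<dots> = 0"
    by (simp add: sum.distrib sum_subtractf sums flip: sum_distrib_left)
  finally have "c $ i * (sqrt (w $ i) - 1) = 0" for i
    by (simp add: sum_nonneg_eq_0_iff)
  then have "w $ i * c $ i = c $ i" for i by (auto simp: mult_eq_0_iff)
  then show ?thesis
    by (simp add: vec_eq_iff diag_mult_vec_nth)
qed

lemma quadratic_diag: "c \<bullet> (diag w *v c) = (\<Sum>i\<in>UNIV. (c $ i)\<^sup>2 * w $ i)"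
  by (simp add: inner_vec_def diag_mult_vec_nth power2_eq_square mult_ac)

lemma entry_congruence:
  "(transpose C ** X ** C) $ e $ e = (C *v axis e 1) \<bullet> (X *v (C *v axis e 1))" for C X :: "real^'n^'n"
  by (simp add: axis_mult_axis[symmetric] inner_vector_matrix_mult flip: matrix_vector_mul_assoc)

lemma columns_eq_if_halfway_entry:
  fixes C :: "real^'n^'n"
  assumes w: "\<And>i. 0 < w $ i"
    and e: "(transpose C ** C) $ e $ e = 1" "(transpose C ** diag w ** C) $ e $ e = 1"
      "(transpose C ** diag (\<chi> i. sqrt (w $ i)) ** C) $ e $ e = 1"
  shows "(transpose C ** diag w ** C) *v axis e 1 = (transpose C ** C) *v axis e 1"
proof -
  let ?c = "C *v axis e 1"
  have "diag w *v ?c = ?c"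
    using e entry_congruence[of C "mat 1" e] entry_congruence[of C "diag w" e]
      entry_congruence[of C "diag (\<chi> i. sqrt (w $ i))" e] w
    by (intro column_fixed_by_diag) (simp_all add: quadratic_diag flip: norm_vec_square power2_norm_eq_inner)
  then show ?thesis by (simp flip: matrix_vector_mul_assoc)
qed

text \<open>
  An affine-invariant geodesic whose \<open>e\<close>-th diagonal entry is \<open>1\<close> at both ends and halfway keeps
  the whole \<open>e\<close>-th column: that entry is a convex function of \<open>t\<close>, and it is strictly convex unless the
  column is constant.
\<close>
theorem columns_eq_if_geodesic_entry:
  fixes S0 S1 :: "real^'n^'n"
  assumes S: "spd S0" "spd S1" and e: "S0 $ e $ e = 1" "S1 $ e $ e = 1" "airm_geodesic S0 S1 (1/2) $ e $ e = 1"
  shows "S1 *v axis e 1 = S0 *v axis e 1"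
proof -
  obtain C :: "real^'n^'n" and w where w: "\<And>i. 0 < w $ i"
    and S0: "S0 = transpose C ** C" and S1: "S1 = transpose C ** diag w ** C"
    and geo: "\<And>t. airm_geodesic S0 S1 t = transpose C ** diag (\<chi> i. w $ i powr t) ** C"
    using airm_simultaneous_diagonalisation[OF S] by blast
  have "(\<chi> i. w $ i powr (1/2)) = (\<chi> i. sqrt (w $ i))"
    using w by (simp add: powr_half_sqrt less_imp_le)
  then show ?thesis
    using columns_eq_if_halfway_entry[OF w, of C e] e unfolding S0 S1 geo[unfolded S0 S1] by simp
qed

lemma spd_path_congruence:
  fixes B :: "real^'n^'n"
  assumes S: "spd_path S S'" and B: "\<And>x. B *v x = 0 \<Longrightarrow> x = 0"
  shows "spd_path (\<lambda>t. transpose B ** S t ** B) (\<lambda>t. transpose B ** S' t ** B)"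
    and "t \<in> {0..1} \<Longrightarrow> airm_speed (\<lambda>t. transpose B ** S t ** B) (\<lambda>t. transpose B ** S' t ** B) t = airm_speed S S' t"
proof -
  have "linear (\<lambda>X. transpose B ** X ** B)"
    by (intro linearI) (simp_all add: matrix_matrix_mult_def vec_eq_iff sum.distrib algebra_simps
        sum_distrib_left sum_distrib_right)
  then have bl: "bounded_linear (\<lambda>X. transpose B ** X ** B)" by (simp add: linear_conv_bounded_linear)
  show *: "spd_path (\<lambda>t. transpose B ** S t ** B) (\<lambda>t. transpose B ** S' t ** B)"
    using S unfolding spd_path_def
    by (auto intro!: bounded_linear.continuous_on[OF bl] bounded_linear.has_vector_derivative[OF bl]
        spd_congruence B simp: matrix_transpose_mul transpose_transpose matrix_mul_assoc)
  show "airm_speed (\<lambda>t. transpose B ** S t ** B) (\<lambda>t. transpose B ** S' t ** B) t = airm_speed S S' t"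
    if "t \<in> {0..1}"
  proof -
    have "spd (transpose B ** S t ** B)" "transpose (S' t) = S' t"
      using S * that unfolding spd_path_def by blast+
    then show ?thesis by (simp add: airm_speed_def airm_congruence)
  qed
qed

definition airm_length :: "(real \<Rightarrow> real^'n^'n) \<Rightarrow> (real \<Rightarrow> real^'n^'n) \<Rightarrow> real" where
  "airm_length S S' = integral {0..1} (airm_speed S S')"

text \<open>
  The congruence by \<open>B\<close> moves a path between arbitrary endpoints into the normal form in which the
  log-pivots of the endpoints are known.
\<close>
lemma normalised_midpoint:
  fixes B C :: "real^'n^'n"
  assumes CB: "C ** B = mat 1" and S: "spd_path S S'"
    and S0: "S 0 = transpose C ** C" and S1: "S 1 = transpose C ** diag w ** C"
    and d: "d = 1 / sqrt 2 * norm (\<chi> i. ln (w $ i))"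
  shows "\<exists>s\<in>{0..1}. \<forall>r. inj r \<longrightarrow>
    norm (log_pivots r (transpose B ** S s ** B) - (1/2) *\<^sub>R (\<chi> i. ln (w $ i))) ^ 2
      \<le> ((airm_length S S')\<^sup>2 - d\<^sup>2) / 2"
proof -
  have inj: "x = 0" if "B *v x = 0" for x using left_invertible_inj[OF CB that] .
  note T = spd_path_congruence[OF S inj]
  have CBt: "transpose B ** transpose C = mat 1"
    using CB by (simp add: transpose_mat flip: matrix_transpose_mul)
  have ends: "transpose B ** S 0 ** B = mat 1" "transpose B ** S 1 ** B = diag w"
    unfolding S0 S1 using CB CBt
    by (simp_all add: matrix_cancel_left matrix_mul_assoc[symmetric])
  have len: "integral {0..1} (airm_speed (\<lambda>t. transpose B ** S t ** B) (\<lambda>t. transpose B ** S' t ** B))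
      = airm_length S S'"
    unfolding airm_length_def by (intro integral_cong T(2))
  show ?thesis using log_pivots_midpoint[OF T(1) ends] unfolding d len .
qed

text \<open>
  The left-hand side of the midpoint estimate is a square, so its bound \<open>(len\<^sup>2 - d\<^sup>2)/2\<close> is not negative.
\<close>
theorem d_airm_le_length:
  fixes S :: "real \<Rightarrow> real^'n^'n"
  assumes S: "spd_path S S'"
  shows "d_airm (S 0) (S 1) \<le> airm_length S S'"
proof -
  have spd: "spd (S 0)" "spd (S 1)" using S by (auto simp: spd_path_def)
  obtain C B :: "real^'n^'n" and w where CB: "C ** B = mat 1" and w: "S 0 = transpose C ** C" "S 1 = transpose C ** diag w ** C"
    "d_airm (S 0) (S 1) = 1 / sqrt 2 * norm (\<chi> i. ln (w $ i))"
    using airm_simultaneous_diagonalisation[OF spd] by blast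
  obtain r :: "'n \<Rightarrow> nat" where r: "inj r" using ex_ranking by blast
  obtain s where "norm (log_pivots r (transpose B ** S s ** B) - (1/2) *\<^sub>R (\<chi> i. ln (w $ i))) ^ 2
      \<le> ((airm_length S S')\<^sup>2 - (d_airm (S 0) (S 1))\<^sup>2) / 2"
    using normalised_midpoint[OF CB S w] r by blast
  from order_trans[OF zero_le_power2 this]
  have "(d_airm (S 0) (S 1))\<^sup>2 \<le> (airm_length S S')\<^sup>2" by simp
  moreover have "0 \<le> airm_length S S'"
    unfolding airm_length_def using airm_speed_nonneg[OF S]
    by (intro Henstock_Kurzweil_Integration.integral_nonneg integrable_continuous_interval airm_speed_continuous[OF S]) auto
  ultimately show ?thesis by (rule power2_le_imp_le)
qed

text \<open>
  The same rigidity without a minimising path: halfway points of almost minimal paths converge, in the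
  normalised coordinates, to \<open>diag(\<surd>w)\<close>, the midpoint of the geodesic, and a prescribed diagonal entry
  passes to the limit.
\<close>
theorem columns_eq_if_distance_approximated:
  fixes S0 S1 :: "real^'n^'n"
  assumes S01: "spd S0" "spd S1"
    and approx: "\<And>\<epsilon>. 0 < \<epsilon> \<Longrightarrow> \<exists>S S'. spd_path S S' \<and> S 0 = S0 \<and> S 1 = S1 \<and>
      (\<forall>t\<in>{0..1}. S t $ e $ e = 1) \<and> airm_length S S' < d_airm S0 S1 + \<epsilon>"
  shows "S1 *v axis e 1 = S0 *v axis e 1"
proof -
  obtain C B :: "real^'n^'n" and w where CB: "C ** B = mat 1" "B ** C = mat 1" and w: "\<And>i. 0 < w $ i"
    and S0: "S0 = transpose C ** C" and S1: "S1 = transpose C ** diag w ** C"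
    and d: "d_airm S0 S1 = 1 / sqrt 2 * norm (\<chi> i. ln (w $ i))"
    using airm_simultaneous_diagonalisation[OF S01] by blast
  let ?d = "d_airm S0 S1" and ?v = "\<chi> i. sqrt (w $ i)" and ?m = "\<chi> i. ln (w $ i)"
  have CBt: "transpose C ** transpose B = mat 1" "transpose B ** transpose C = mat 1"
    using CB by (simp_all add: transpose_mat flip: matrix_transpose_mul)
  have "0 \<le> ?d" by (simp add: d)
  define \<epsilon> where "\<epsilon> n = 1 / real (Suc n)" for n
  have "\<exists>X. spd X \<and> (transpose C ** X ** C) $ e $ e = 1 \<and>
    (\<forall>r. inj r \<longrightarrow> norm (log_pivots r X - (1/2) *\<^sub>R ?m) ^ 2 \<le> ((?d + \<epsilon> n)\<^sup>2 - ?d\<^sup>2) / 2)" for n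
  proof -
    obtain S S' where S: "spd_path S S'" "S 0 = S0" "S 1 = S1"
      "\<forall>t\<in>{0..1}. S t $ e $ e = 1" "airm_length S S' < ?d + \<epsilon> n"
      using approx[of "\<epsilon> n"] by (auto simp: \<epsilon>_def)
    obtain s where s: "s \<in> {0..1}" "\<forall>r. inj r \<longrightarrow>
      norm (log_pivots r (transpose B ** S s ** B) - (1/2) *\<^sub>R ?m) ^ 2 \<le> ((airm_length S S')\<^sup>2 - ?d\<^sup>2) / 2"
      using normalised_midpoint[OF CB(1) S(1) S(2)[unfolded S0] S(3)[unfolded S1] d] by blast
    have "?d \<le> airm_length S S'" using d_airm_le_length[OF S(1)] S(2,3) by simp
    then have "(airm_length S S')\<^sup>2 \<le> (?d + \<epsilon> n)\<^sup>2"
      using S(5) \<open>0 \<le> ?d\<close> by (intro power_mono) auto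
    moreover have "spd (transpose B ** S s ** B)"
      using spd_path_congruence(1)[OF S(1) left_invertible_inj[OF CB(1)]] s(1)
      by (simp add: spd_path_def)
    moreover have "transpose C ** (transpose B ** S s ** B) ** C = S s"
      using CB CBt by (simp add: matrix_cancel_left matrix_mul_assoc[symmetric])
    ultimately show ?thesis using s S(4)
      by (intro exI[of _ "transpose B ** S s ** B"]) (fastforce intro: order_trans)
  qed
  then have "\<forall>n. \<exists>X. spd X \<and> (transpose C ** X ** C) $ e $ e = 1 \<and>
    (\<forall>r. inj r \<longrightarrow> norm (log_pivots r X - (1/2) *\<^sub>R ?m) ^ 2 \<le> ((?d + \<epsilon> n)\<^sup>2 - ?d\<^sup>2) / 2)" ..
  from choice[OF this] obtain X where X: "\<And>n. spd (X n)" "\<And>n. (transpose C ** X n ** C) $ e $ e = 1"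
    "\<And>r n. inj r \<Longrightarrow> norm (log_pivots r (X n) - (1/2) *\<^sub>R ?m) ^ 2 \<le> ((?d + \<epsilon> n)\<^sup>2 - ?d\<^sup>2) / 2"
    by blast
  have \<epsilon>: "\<epsilon> \<longlonglongrightarrow> 0" unfolding \<epsilon>_def using LIMSEQ_inverse_real_of_nat by (simp add: inverse_eq_divide)
  have "(\<lambda>n. pivot r (X n) i) \<longlonglongrightarrow> ?v $ i" if r: "inj r" for r i
  proof -
    let ?f = "\<lambda>n. log_pivots r (X n) - (1/2) *\<^sub>R ?m"
    have "(\<lambda>n. ((?d + \<epsilon> n)\<^sup>2 - ?d\<^sup>2) / 2) \<longlonglongrightarrow> ((?d + 0)\<^sup>2 - ?d\<^sup>2) / 2"
      by (intro tendsto_intros \<epsilon>) simp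
    then have lim: "(\<lambda>n. ((?d + \<epsilon> n)\<^sup>2 - ?d\<^sup>2) / 2) \<longlonglongrightarrow> 0" by simp
    have "(\<lambda>n. norm (?f n) ^ 2) \<longlonglongrightarrow> 0"
    proof (rule tendsto_sandwich[OF _ _ tendsto_const lim])
      show "\<forall>\<^sub>F n in sequentially. 0 \<le> norm (?f n) ^ 2" by simp
      show "\<forall>\<^sub>F n in sequentially. norm (?f n) ^ 2 \<le> ((?d + \<epsilon> n)\<^sup>2 - ?d\<^sup>2) / 2"
        using X(3)[OF r] by (intro always_eventually allI)
    qed
    from tendsto_norm_zero_cancel[OF tendsto_zero_if_square[OF this]]
    have "?f \<longlonglongrightarrow> 0" .
    then have "(\<lambda>n. log_pivots r (X n)) \<longlonglongrightarrow> (1/2) *\<^sub>R ?m" by (simp only: LIM_zero_iff)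
    from tendsto_vec_nth[OF this, of i]
    have "(\<lambda>n. ln (pivot r (X n) i)) \<longlonglongrightarrow> ln (w $ i) / 2" by (simp add: log_pivots_def)
    then have "(\<lambda>n. exp (ln (pivot r (X n) i))) \<longlonglongrightarrow> exp (ln (w $ i) / 2)"
      by (rule tendsto_exp)
    moreover have "exp (ln (w $ i) / 2) = sqrt (w $ i)"
      unfolding ln_sqrt[OF less_imp_le[OF w[of i]], symmetric] using w[of i] by simp
    moreover have "exp (ln (pivot r (X n) i)) = pivot r (X n) i" for n
      by (rule exp_ln[OF pivot_pos[OF X(1)]])
    ultimately show ?thesis by simp
  qed
  then have "X \<longlonglongrightarrow> diag ?v" by (rule tendsto_diag_if_pivots_tendsto[OF X(1)])
  then have "(\<lambda>n. (C *v axis e 1) \<bullet> (X n *v (C *v axis e 1))) \<longlonglongrightarrow> (C *v axis e 1) \<bullet> (diag ?v *v (C *v axis e 1))"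
    by (intro tendsto_intros bounded_bilinear.tendsto[OF bounded_bilinear_matrix_vector_mult])
  then have "(transpose C ** diag ?v ** C) $ e $ e = 1"
    using X(2) unfolding entry_congruence by (simp add: LIMSEQ_const_iff)
  moreover obtain S S' where "spd_path S S'" "S 0 = S0" "S 1 = S1" "\<forall>t\<in>{0..1}. S t $ e $ e = 1"
    using approx[of 1] by auto
  then have "S0 $ e $ e = 1" "S1 $ e $ e = 1" by auto
  ultimately show ?thesis using columns_eq_if_halfway_entry[OF w, of C e] unfolding S0 S1 by simp
qed

section \<open>Exponential moments\<close>

text \<open>
  Used to differentiate integrals: the remainder is estimated pointwise under the integral sign, with
  one integrable dominating function.
\<close>
lemma has_derivative_if_quadratic_remainder:
  fixes f :: "'a::real_normed_vector \<Rightarrow> 'b::real_normed_vector"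
  assumes L: "bounded_linear L" and \<delta>: "0 < \<delta>"
    and rem: "\<And>h. norm h < \<delta> \<Longrightarrow> norm (f (x + h) - f x - L h) \<le> C * (norm h)\<^sup>2"
  shows "(f has_derivative L) (at x)"
  unfolding has_derivative_at
proof (intro conjI L)
  have lim: "((\<lambda>h::'a. C * norm h) \<longlongrightarrow> 0) (at 0)"
    by (intro tendsto_mult_right_zero tendsto_norm_zero tendsto_ident_at)
  have "\<forall>\<^sub>F h in at 0. norm (f (x + h) - f x - L h) / norm h \<le> C * norm h"
    unfolding eventually_at
  proof (intro exI[of _ \<delta>] conjI \<delta> ballI impI)
    fix h :: 'a assume "h \<noteq> 0 \<and> dist h 0 < \<delta>"
    then show "norm (f (x + h) - f x - L h) / norm h \<le> C * norm h"
      using rem[of h] by (simp add: divide_le_eq power2_eq_square mult.assoc)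
  qed
  then show "(\<lambda>h. norm (f (x + h) - f x - L h) / norm h) \<midarrow>0\<rightarrow> 0"
    by (intro tendsto_sandwich[OF _ _ tendsto_const lim]) auto
qed

lemma integral_norm_le_AE:
  fixes f :: "'a \<Rightarrow> 'b::{banach, second_countable_topology}"
  assumes "integrable N f" "integrable N g" "AE x in N. norm (f x) \<le> g x"
  shows "norm (\<integral>x. f x \<partial>N) \<le> (\<integral>x. g x \<partial>N)"
  by (rule order_trans[OF integral_norm_bound integral_mono_AE[OF integrable_norm[OF assms(1)] assms(2,3)]])

lemma exp_le_chord:
  fixes a b t :: real
  assumes "0 \<le> t" "t \<le> 1"
  shows "exp ((1 - t) * a + t * b) \<le> (1 - t) * exp a + t * exp b"
  using convex_onD[OF exp_convex, of t a b] assms by simp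

lemma exp_second_order_remainder: "\<bar>exp y - 1 - y\<bar> \<le> y\<^sup>2 * exp \<bar>y\<bar>" for y :: real
proof (cases "0 \<le> y")
  case True
  have "1 - y \<le> exp (- y)" using exp_ge_add_one_self[of "-y"] by simp
  then have "exp y * (1 - y) \<le> exp y * exp (- y)" by simp
  then have "exp y - 1 \<le> y * exp y" by (simp add: algebra_simps flip: exp_add)
  then have "y * (exp y - 1) \<le> y * (y * exp y)" using True by (rule mult_left_mono)
  moreover have "y + y * y \<le> y * exp y"
    using mult_left_mono[OF exp_ge_add_one_self[of y] True] by (simp add: algebra_simps)
  moreover have "0 \<le> exp y - 1 - y" using exp_ge_add_one_self[of y] by linarith
  ultimately show ?thesis using True \<open>exp y - 1 \<le> y * exp y\<close>
    by (simp add: algebra_simps power2_eq_square)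
next
  case False
  define z where "z = - y"
  have z: "0 < z" using False by (simp add: z_def)
  have "1 + z \<le> exp z" by simp
  then have "exp (- z) \<le> 1 / (1 + z)" using z by (simp add: exp_minus field_simps)
  also have "\<dots> \<le> 1 - z + z\<^sup>2"
    using z by (simp add: field_simps power2_eq_square)
  finally have "exp (- z) - 1 + z \<le> z\<^sup>2" by simp
  moreover have "z\<^sup>2 \<le> z\<^sup>2 * exp z" using z by (simp add: mult_le_cancel_left1)
  moreover have "0 \<le> exp (- z) - 1 + z" using exp_ge_add_one_self[of "-z"] by simp
  ultimately have "\<bar>exp (- z) - 1 + z\<bar> \<le> z\<^sup>2 * exp z" by linarith
  then show ?thesis using False by (simp add: z_def)
qed

lemma exp_abs_le_cosh: "exp \<bar>x\<bar> \<le> 2 * cosh x" for x :: real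
  by (cases "0 \<le> x") (simp_all add: cosh_def)

lemma cosh_le_exp_abs: "cosh x \<le> exp \<bar>x\<bar>" for x :: real
  by (cases "0 \<le> x") (simp_all add: cosh_def)

lemma cosh_scaled_le:
  fixes t x :: real
  assumes "0 \<le> t" "t \<le> 1"
  shows "cosh (t * x) - 1 \<le> t * (cosh x - 1)"
  using exp_le_chord[OF assms, of 0 x] exp_le_chord[OF assms, of 0 "-x"]
  by (simp add: cosh_def field_simps)

locale reference_density =
  fixes M :: "'x measure" and p :: "'x \<Rightarrow> real"
  assumes density: "p \<in> densities M"
begin

lemma p_measurable [measurable]: "p \<in> borel_measurable M"
  and p_pos: "AE x in M. 0 < p x"
  and p_integrable: "integrable M p"
  and p_total: "(\<integral>x. p x \<partial>M) = 1"
  using density by (auto simp: densities_def)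

lemma integrable_dominated:
  assumes "integrable M (\<lambda>x. g x * p x)" and [measurable]: "f \<in> borel_measurable M"
    and "\<And>x. \<bar>f x\<bar> \<le> g x"
  shows "integrable M (\<lambda>x. f x * p x)"
proof (rule Bochner_Integration.integrable_bound[OF assms(1)])
  show "AE x in M. norm (f x * p x) \<le> norm (g x * p x)"
    using order_trans[OF assms(3) abs_ge_self] by (auto simp: abs_mult mult_right_mono)
qed measurable

lemma nn_expect_finite_iff:
  assumes [measurable]: "f \<in> borel_measurable M" and "\<And>x. 0 \<le> f x"
  shows "nn_expect M p f < \<infinity> \<longleftrightarrow> integrable M (\<lambda>x. f x * p x)"
proof -
  have "nn_expect M p f = (\<integral>\<^sup>+x. ennreal (norm (f x * p x)) \<partial>M)"
    unfolding nn_expect_def using p_pos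
    by (intro nn_integral_cong_AE) (auto elim!: eventually_mono simp: assms)
  then show ?thesis by (simp add: integrable_iff_bounded)
qed

lemma nn_expect_eq_expect:
  assumes "integrable M (\<lambda>x. f x * p x)" and "\<And>x. 0 \<le> f x"
  shows "nn_expect M p f = ennreal (expect M p f)"
  unfolding nn_expect_def expect_def using p_pos
  by (intro nn_integral_eq_integral assms) (auto elim!: eventually_mono simp: assms)

text \<open>
  Exponentials of absolute values are easier to multiply and compare than hyperbolic cosines.
\<close>
lemma B_space_iff:
  "v \<in> B_space M p \<longleftrightarrow> v \<in> borel_measurable M \<and>
    (\<exists>\<alpha>>0. integrable M (\<lambda>x. exp (\<alpha> * \<bar>v x\<bar>) * p x)) \<and> expect M p v = 0"
proof -
  have "nn_expect M p (\<lambda>x. cosh (\<alpha> * v x) - 1) < \<infinity>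
      \<longleftrightarrow> integrable M (\<lambda>x. exp (\<alpha> * \<bar>v x\<bar>) * p x)" (is "?l \<longleftrightarrow> ?r")
    if [measurable]: "v \<in> borel_measurable M" and \<alpha>: "0 < \<alpha>" for \<alpha>
  proof -
    have [measurable]: "(\<lambda>x. cosh (\<alpha> * v x)) \<in> borel_measurable M"
      unfolding cosh_def by measurable
    have "?l \<longleftrightarrow> integrable M (\<lambda>x. (cosh (\<alpha> * v x) - 1) * p x)"
      by (rule nn_expect_finite_iff) (auto simp: cosh_real_ge_1)
    also have "\<dots> \<longleftrightarrow> ?r"
    proof
      assume "integrable M (\<lambda>x. (cosh (\<alpha> * v x) - 1) * p x)"
      then have "integrable M (\<lambda>x. 2 * ((cosh (\<alpha> * v x) - 1) * p x) + 2 * p x)"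
        using p_integrable by (intro Bochner_Integration.integrable_add integrable_mult_right)
      then have "integrable M (\<lambda>x. (2 * cosh (\<alpha> * v x)) * p x)" by (simp add: algebra_simps)
      then show ?r
      proof (rule integrable_dominated)
        fix x
        have "\<bar>\<alpha> * v x\<bar> = \<alpha> * \<bar>v x\<bar>" using \<alpha> by (simp add: abs_mult)
        then show "\<bar>exp (\<alpha> * \<bar>v x\<bar>)\<bar> \<le> 2 * cosh (\<alpha> * v x)"
          using exp_abs_le_cosh[of "\<alpha> * v x"] by simp
      qed measurable
    next
      assume ?r
      then show "integrable M (\<lambda>x. (cosh (\<alpha> * v x) - 1) * p x)"
      proof (rule integrable_dominated)
        fix x
        have "\<bar>\<alpha> * v x\<bar> = \<alpha> * \<bar>v x\<bar>" using \<alpha> by (simp add: abs_mult)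
        then show "\<bar>cosh (\<alpha> * v x) - 1\<bar> \<le> exp (\<alpha> * \<bar>v x\<bar>)"
          using cosh_le_exp_abs[of "\<alpha> * v x"] cosh_real_ge_1[of "\<alpha> * v x"] by simp
      qed measurable
    qed
    finally show ?thesis .
  qed
  then show ?thesis unfolding B_space_def by blast
qed

lemma B_space_measurable: "v \<in> B_space M p \<Longrightarrow> v \<in> borel_measurable M"
  by (simp add: B_space_def)

lemma B_space_expect: "v \<in> B_space M p \<Longrightarrow> expect M p v = 0"
  by (simp add: B_space_def)

lemma B_space_integrable:
  assumes "v \<in> B_space M p"
  shows "integrable M (\<lambda>x. v x * p x)"
proof -
  have [measurable]: "v \<in> borel_measurable M" by (rule B_space_measurable[OF assms])
  obtain \<alpha> where \<alpha>: "0 < \<alpha>" "integrable M (\<lambda>x. exp (\<alpha> * \<bar>v x\<bar>) * p x)"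
    using assms by (auto simp: B_space_iff)
  have "integrable M (\<lambda>x. (1 / \<alpha> * exp (\<alpha> * \<bar>v x\<bar>)) * p x)"
    using integrable_mult_right[OF \<alpha>(2), of "1 / \<alpha>"] by (simp add: mult.assoc)
  then show ?thesis
  proof (rule integrable_dominated)
    fix x
    have "\<alpha> * \<bar>v x\<bar> \<le> exp (\<alpha> * \<bar>v x\<bar>)" using exp_ge_add_one_self[of "\<alpha> * \<bar>v x\<bar>"] by linarith
    then show "\<bar>v x\<bar> \<le> 1 / \<alpha> * exp (\<alpha> * \<bar>v x\<bar>)" using \<alpha>(1) by (simp add: field_simps)
  qed measurable
qed

lemma B_space_lin:
  assumes v: "v \<in> B_space M p" and w: "w \<in> B_space M p"
  shows "(\<lambda>x. a * v x + b * w x) \<in> B_space M p"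
proof -
  note [measurable] = B_space_measurable[OF v] B_space_measurable[OF w]
  obtain \<alpha> \<beta> where \<alpha>: "0 < \<alpha>" "integrable M (\<lambda>x. exp (\<alpha> * \<bar>v x\<bar>) * p x)"
    and \<beta>: "0 < \<beta>" "integrable M (\<lambda>x. exp (\<beta> * \<bar>w x\<bar>) * p x)"
    using v w unfolding B_space_iff by blast
  \<comment> \<open>Small enough that both summands stay below \<open>\<alpha>\<close> and \<open>\<beta>\<close> after convexity has doubled them.\<close>
  define \<gamma> where "\<gamma> = min \<alpha> \<beta> / (2 * (\<bar>a\<bar> + \<bar>b\<bar> + 1))"
  have \<gamma>: "0 < \<gamma>" using \<alpha> \<beta> by (simp add: \<gamma>_def)
  have small: "2 * \<gamma> * \<bar>a\<bar> \<le> \<alpha>" "2 * \<gamma> * \<bar>b\<bar> \<le> \<beta>"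
  proof -
    have "2 * \<gamma> * (\<bar>a\<bar> + \<bar>b\<bar> + 1) = min \<alpha> \<beta>" by (simp add: \<gamma>_def field_simps add_nonneg_eq_0_iff)
    then have m: "2 * \<gamma> * \<bar>a\<bar> + 2 * \<gamma> * \<bar>b\<bar> + 2 * \<gamma> = min \<alpha> \<beta>" by (simp add: algebra_simps)
    have "0 \<le> 2 * \<gamma> * \<bar>a\<bar>" "0 \<le> 2 * \<gamma> * \<bar>b\<bar>" using \<gamma> by simp_all
    then show "2 * \<gamma> * \<bar>a\<bar> \<le> \<alpha>" "2 * \<gamma> * \<bar>b\<bar> \<le> \<beta>" using m \<gamma> by linarith+
  qed
  have "integrable M (\<lambda>x. (exp (\<alpha> * \<bar>v x\<bar>) + exp (\<beta> * \<bar>w x\<bar>)) * p x)"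
    using Bochner_Integration.integrable_add[OF \<alpha>(2) \<beta>(2)] by (simp add: algebra_simps)
  then have "integrable M (\<lambda>x. exp (\<gamma> * \<bar>a * v x + b * w x\<bar>) * p x)"
  proof (rule integrable_dominated)
    fix x
    have tri: "\<bar>a * v x + b * w x\<bar> \<le> \<bar>a\<bar> * \<bar>v x\<bar> + \<bar>b\<bar> * \<bar>w x\<bar>"
      by (metis abs_mult abs_triangle_ineq)
    have "\<gamma> * \<bar>a * v x + b * w x\<bar> \<le> \<gamma> * (\<bar>a\<bar> * \<bar>v x\<bar> + \<bar>b\<bar> * \<bar>w x\<bar>)"
      using tri \<gamma> by (intro mult_left_mono) auto
    also have "\<dots> = (1 - 1/2) * (2 * \<gamma> * \<bar>a\<bar> * \<bar>v x\<bar>) + 1/2 * (2 * \<gamma> * \<bar>b\<bar> * \<bar>w x\<bar>)"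
      by (simp add: algebra_simps)
    finally have "exp (\<gamma> * \<bar>a * v x + b * w x\<bar>)
        \<le> exp ((1 - 1/2) * (2 * \<gamma> * \<bar>a\<bar> * \<bar>v x\<bar>) + 1/2 * (2 * \<gamma> * \<bar>b\<bar> * \<bar>w x\<bar>))"
      by (simp only: exp_le_cancel_iff)
    also have "\<dots> \<le> (1 - 1/2) * exp (2 * \<gamma> * \<bar>a\<bar> * \<bar>v x\<bar>) + 1/2 * exp (2 * \<gamma> * \<bar>b\<bar> * \<bar>w x\<bar>)"
      by (rule exp_le_chord) simp_all
    finally have "exp (\<gamma> * \<bar>a * v x + b * w x\<bar>)
        \<le> (1 - 1/2) * exp (2 * \<gamma> * \<bar>a\<bar> * \<bar>v x\<bar>) + 1/2 * exp (2 * \<gamma> * \<bar>b\<bar> * \<bar>w x\<bar>)" .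
    moreover have mono: "exp (2 * \<gamma> * \<bar>a\<bar> * \<bar>v x\<bar>) \<le> exp (\<alpha> * \<bar>v x\<bar>)"
      "exp (2 * \<gamma> * \<bar>b\<bar> * \<bar>w x\<bar>) \<le> exp (\<beta> * \<bar>w x\<bar>)"
      using small by (simp_all add: mult_right_mono)
    moreover have "(1 - 1/2) * exp (2 * \<gamma> * \<bar>a\<bar> * \<bar>v x\<bar>) + 1/2 * exp (2 * \<gamma> * \<bar>b\<bar> * \<bar>w x\<bar>)
        \<le> (1 - 1/2) * exp (\<alpha> * \<bar>v x\<bar>) + 1/2 * exp (\<beta> * \<bar>w x\<bar>)"
      by (intro add_mono mult_left_mono mono) simp_all
    ultimately have "exp (\<gamma> * \<bar>a * v x + b * w x\<bar>) \<le> (1 - 1/2) * exp (\<alpha> * \<bar>v x\<bar>) + 1/2 * exp (\<beta> * \<bar>w x\<bar>)"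
      by (blast intro: order_trans)
    also have "\<dots> \<le> exp (\<alpha> * \<bar>v x\<bar>) + exp (\<beta> * \<bar>w x\<bar>)" by (intro add_mono) simp_all
    finally show "\<bar>exp (\<gamma> * \<bar>a * v x + b * w x\<bar>)\<bar> \<le> exp (\<alpha> * \<bar>v x\<bar>) + exp (\<beta> * \<bar>w x\<bar>)" by simp
  qed measurable
  moreover have "expect M p (\<lambda>x. a * v x + b * w x) = a * expect M p v + b * expect M p w"
    unfolding expect_def using B_space_integrable[OF v] B_space_integrable[OF w]
    by (simp add: algebra_simps)
  ultimately show ?thesis
    using \<gamma> B_space_expect[OF v] B_space_expect[OF w] by (auto simp: B_space_iff)
qed

text \<open>
  Continuity of scalar multiplication at \<open>0\<close>. Since \<open>cosh - 1\<close> is convex and vanishes at \<open>0\<close>, shrinking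
  the argument by a factor \<open>\<tau>\<close> shrinks the expectation by at least \<open>\<tau>\<close>.
\<close>
lemma B_norm_small_multiple:
  assumes v: "v \<in> B_space M p" and \<epsilon>: "0 < \<epsilon>"
  shows "\<exists>s>0. \<forall>c. \<bar>c\<bar> \<le> s \<longrightarrow> B_norm M p (\<lambda>x. c * v x) < \<epsilon>"
proof -
  note [measurable] = B_space_measurable[OF v]
  obtain \<alpha> where \<alpha>: "0 < \<alpha>" "nn_expect M p (\<lambda>x. cosh (\<alpha> * v x) - 1) < \<infinity>"
    using v by (auto simp: B_space_def)
  have [measurable]: "(\<lambda>x. cosh (a * v x)) \<in> borel_measurable M" for a
    unfolding cosh_def by measurable
  define f where "f x = cosh (\<alpha> * v x) - 1" for x
  have f [measurable]: "f \<in> borel_measurable M" and f0: "0 \<le> f x" for x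
    unfolding f_def by (measurable, simp add: cosh_real_ge_1)
  have fi: "integrable M (\<lambda>x. f x * p x)"
    using \<alpha>(2) nn_expect_finite_iff[OF f f0] by (simp add: f_def)
  define I where "I = expect M p f"
  have I: "0 \<le> I" unfolding I_def expect_def using p_pos
    by (intro integral_nonneg_AE) (auto elim!: eventually_mono simp: f0)
  define \<tau> where "\<tau> = 1 / (I + 1)"
  have \<tau>: "0 < \<tau>" "\<tau> \<le> 1" "\<tau> * I \<le> 1" using I by (simp_all add: \<tau>_def field_simps)
  define s where "s = \<tau> * \<alpha> * (\<epsilon> / 2)"
  have "B_norm M p (\<lambda>x. c * v x) < \<epsilon>" if c: "\<bar>c\<bar> \<le> s" for c
  proof -
    define t where "t = \<bar>c\<bar> / (\<alpha> * (\<epsilon> / 2))"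
    have t: "0 \<le> t" "t \<le> \<tau>" using c \<alpha>(1) \<epsilon> by (simp_all add: t_def s_def field_simps)
    have le: "cosh (c * v x / (\<epsilon> / 2)) - 1 \<le> \<tau> * f x" for x
    proof -
      have "\<bar>c * v x / (\<epsilon> / 2)\<bar> = \<bar>t * (\<alpha> * v x)\<bar>"
        using \<alpha>(1) \<epsilon> by (simp add: t_def abs_mult)
      then have "cosh (c * v x / (\<epsilon> / 2)) = cosh (t * (\<alpha> * v x))"
        by (metis cosh_real_abs)
      also have "\<dots> - 1 \<le> t * f x"
        unfolding f_def using t \<tau> by (intro cosh_scaled_le) auto
      also have "\<dots> \<le> \<tau> * f x" using t f0 by (intro mult_right_mono)
      finally show ?thesis .
    qed
    have "nn_expect M p (\<lambda>x. cosh (c * v x / (\<epsilon> / 2)) - 1) \<le> nn_expect M p (\<lambda>x. \<tau> * f x)"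
      unfolding nn_expect_def using p_pos
      by (intro nn_integral_mono_AE, elim eventually_mono)
         (intro ennreal_leI mult_right_mono le less_imp_le)
    also have "\<dots> = ennreal (expect M p (\<lambda>x. \<tau> * f x))"
      using integrable_mult_right[OF fi, of \<tau>] \<tau> f0
      by (intro nn_expect_eq_expect) (simp_all add: mult.assoc)
    also have "expect M p (\<lambda>x. \<tau> * f x) = \<tau> * I"
      by (simp add: expect_def I_def mult.assoc)
    finally have "nn_expect M p (\<lambda>x. cosh (c * v x / (\<epsilon> / 2)) - 1) \<le> 1"
      using \<tau>(3) by (simp add: order_trans)
    then have "B_norm M p (\<lambda>x. c * v x) \<le> \<epsilon> / 2"
      unfolding B_norm_def using \<epsilon> by (intro cInf_lower bdd_belowI[of _ 0]) auto
    then show ?thesis using \<epsilon> by simp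
  qed
  moreover have "0 < s" using \<tau> \<alpha> \<epsilon> by (simp add: s_def)
  ultimately show ?thesis by blast
qed

lemma Dom_K_iff:
  "v \<in> Dom_K M p \<longleftrightarrow> v \<in> B_space M p \<and> integrable M (\<lambda>x. exp (v x) * p x)"
proof -
  have "K M p v < \<infinity> \<longleftrightarrow> integrable M (\<lambda>x. exp (v x) * p x)" if "v \<in> B_space M p"
  proof -
    note [measurable] = B_space_measurable[OF that]
    have "K M p v < \<infinity> \<longleftrightarrow> nn_expect M p (\<lambda>x. exp (v x)) < \<infinity>"
      by (auto simp: K_def Let_def less_top[symmetric])
    also have "\<dots> \<longleftrightarrow> integrable M (\<lambda>x. exp (v x) * p x)"
      by (rule nn_expect_finite_iff) auto
    finally show ?thesis .
  qed
  then show ?thesis by (auto simp: Dom_K_def)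
qed

end

lemma lin_comb_add: "lin_comb u (\<theta> + \<eta>) x = lin_comb u \<theta> x + lin_comb u \<eta> x"
  by (simp add: lin_comb_def algebra_simps sum.distrib)

lemma lin_comb_scaleR: "lin_comb u (c *\<^sub>R \<theta>) x = c * lin_comb u \<theta> x"
  by (simp add: lin_comb_def mult.assoc sum_distrib_left)

lemma lin_comb_diff: "lin_comb u (\<theta> - \<eta>) x = lin_comb u \<theta> x - lin_comb u \<eta> x"
  by (simp add: lin_comb_def algebra_simps sum_subtractf)

locale exponential_family = reference_density M p
  for M :: "'x measure" and p :: "'x \<Rightarrow> real" +
  fixes u :: "'d::finite \<Rightarrow> 'x \<Rightarrow> real"
  assumes u_B_space: "u j \<in> B_space M p"
begin

lemma u_measurable [measurable]: "u j \<in> borel_measurable M"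
  by (rule B_space_measurable[OF u_B_space])

lemma lin_comb_measurable [measurable]: "lin_comb u \<theta> \<in> borel_measurable M"
  unfolding lin_comb_def by measurable

lemma lin_comb_B_space: "lin_comb u \<theta> \<in> B_space M p"
proof -
  have zero: "(\<lambda>x. 0) \<in> B_space M p"
    using p_integrable by (auto simp: B_space_iff expect_def intro!: exI[of _ 1])
  have "(\<lambda>x. \<Sum>j\<in>J. \<theta> $ j * u j x) \<in> B_space M p" for J
  proof (induction J rule: infinite_finite_induct)
    case (insert j J)
    then show ?case using B_space_lin[OF u_B_space insert.IH, of "\<theta> $ j" j 1] by simp
  qed (simp_all add: zero)
  then show ?thesis by (simp add: lin_comb_def)
qed

definition abs_sum :: "'x \<Rightarrow> real" where
  "abs_sum x = (\<Sum>j\<in>UNIV. \<bar>u j x\<bar>)"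

lemma abs_sum_measurable [measurable]: "abs_sum \<in> borel_measurable M"
  unfolding abs_sum_def by measurable

lemma abs_sum_nonneg: "0 \<le> abs_sum x"
  by (simp add: abs_sum_def sum_nonneg)

lemma abs_u_le: "\<bar>u j x\<bar> \<le> abs_sum x"
  unfolding abs_sum_def by (rule member_le_sum) auto

lemma lin_comb_le_abs_sum: "\<bar>lin_comb u \<theta> x\<bar> \<le> norm \<theta> * abs_sum x"
proof -
  have "\<bar>lin_comb u \<theta> x\<bar> \<le> (\<Sum>j\<in>UNIV. \<bar>\<theta> $ j * u j x\<bar>)"
    unfolding lin_comb_def by (rule sum_abs)
  also have "\<dots> \<le> (\<Sum>j\<in>UNIV. norm \<theta> * \<bar>u j x\<bar>)"
    by (intro sum_mono) (simp add: abs_mult component_le_norm_cart mult_right_mono)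
  finally show ?thesis by (simp add: abs_sum_def sum_distrib_left)
qed

text \<open>
  The form in which interiority of a parameter is used: there is exponential integrability with a
  margin in all directions at once.
\<close>
definition regular :: "(real^'d) set" where
  "regular = {\<theta>. \<exists>s>0. integrable M (\<lambda>x. exp (lin_comb u \<theta> x + s * abs_sum x) * p x)}"

lemma exp_abs_sum_le:
  assumes "0 \<le> s"
  shows "exp (s * abs_sum x) \<le> (\<Sum>j\<in>UNIV. exp (s * CARD('d) * u j x) + exp (- (s * CARD('d) * u j x)))"
proof -
  obtain k where k: "\<And>j. \<bar>u j x\<bar> \<le> \<bar>u k x\<bar>"
  proof -
    have "Max (range (\<lambda>j. \<bar>u j x\<bar>)) \<in> range (\<lambda>j. \<bar>u j x\<bar>)" by (intro Max_in) auto
    then obtain k where "Max (range (\<lambda>j. \<bar>u j x\<bar>)) = \<bar>u k x\<bar>" by (rule rangeE)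
    then show ?thesis using that[of k] Max_ge[of "range (\<lambda>j. \<bar>u j x\<bar>)"] by auto
  qed
  have "abs_sum x \<le> CARD('d) * \<bar>u k x\<bar>"
    unfolding abs_sum_def using sum_bounded_above[of UNIV "\<lambda>j. \<bar>u j x\<bar>"] k by simp
  then have "exp (s * abs_sum x) \<le> exp (s * CARD('d) * \<bar>u k x\<bar>)"
    using mult_left_mono[OF _ assms] by (simp add: mult.assoc)
  also have "\<dots> \<le> exp (s * CARD('d) * u k x) + exp (- (s * CARD('d) * u k x))"
    by (cases "0 \<le> u k x") simp_all
  also have "\<dots> \<le> (\<Sum>j\<in>UNIV. exp (s * CARD('d) * u j x) + exp (- (s * CARD('d) * u j x)))"
    by (rule member_le_sum) auto
  finally show ?thesis .
qed

text \<open>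
  The definition of the interior gives integrability of \<open>exp(\<theta>\<cdot>u \<plusminus> m u\<^sub>j)\<close> for each \<open>j\<close>
  separately; a sum of these finitely many functions dominates \<open>exp(\<theta>\<cdot>u + (m/d) \<Sum>\<^sub>j \<bar>u\<^sub>j\<bar>)\<close>.
\<close>
lemma param_space_regular:
  assumes "\<theta> \<in> param_space M p u"
  shows "\<theta> \<in> regular"
proof -
  obtain \<epsilon> where \<epsilon>: "0 < \<epsilon>"
    "\<And>v. v \<in> B_space M p \<Longrightarrow> B_norm M p (\<lambda>x. v x - lin_comb u \<theta> x) < \<epsilon> \<Longrightarrow> v \<in> Dom_K M p"
    using assms by (auto simp: param_space_def Dom_K_interior_def)
  have "\<forall>j. \<exists>s>0. \<forall>c. \<bar>c\<bar> \<le> s \<longrightarrow> B_norm M p (\<lambda>x. c * u j x) < \<epsilon>"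
    using B_norm_small_multiple[OF u_B_space \<epsilon>(1)] by blast
  from choice[OF this] obtain s where s: "\<And>j. 0 < s j"
    "\<And>j c. \<bar>c\<bar> \<le> s j \<Longrightarrow> B_norm M p (\<lambda>x. c * u j x) < \<epsilon>" by blast
  define m where "m = Min (range s)"
  have m: "0 < m" "\<And>j. m \<le> s j" using s(1) by (auto simp: m_def)
  have int: "integrable M (\<lambda>x. exp (lin_comb u \<theta> x + c * u j x) * p x)" if "\<bar>c\<bar> \<le> m" for c j
  proof -
    have "(\<lambda>x. lin_comb u \<theta> x + c * u j x) \<in> B_space M p"
      using B_space_lin[OF lin_comb_B_space u_B_space, of 1 \<theta> c j] by simp
    then have "(\<lambda>x. lin_comb u \<theta> x + c * u j x) \<in> Dom_K M p"
      using s(2)[of c j] that m(2)[of j] by (intro \<epsilon>(2)) simp_all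
    then show ?thesis by (simp add: Dom_K_iff)
  qed
  let ?s = "m / CARD('d)"
  have "integrable M (\<lambda>x. (\<Sum>j\<in>UNIV. exp (lin_comb u \<theta> x + m * u j x) + exp (lin_comb u \<theta> x + (- m) * u j x)) * p x)"
    using int[of m] int[of "-m"] m(1)
    by (simp add: sum_distrib_right distrib_right)
  then have "integrable M (\<lambda>x. exp (lin_comb u \<theta> x + ?s * abs_sum x) * p x)"
  proof (rule integrable_dominated)
    fix x
    have "exp (?s * abs_sum x) \<le> (\<Sum>j\<in>UNIV. exp (m * u j x) + exp (- (m * u j x)))"
      using exp_abs_sum_le[of ?s x] m(1) by simp
    then have "exp (lin_comb u \<theta> x) * exp (?s * abs_sum x)
      \<le> exp (lin_comb u \<theta> x) * (\<Sum>j\<in>UNIV. exp (m * u j x) + exp (- (m * u j x)))"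
      by (rule mult_left_mono) simp
    then show "\<bar>exp (lin_comb u \<theta> x + ?s * abs_sum x)\<bar>
      \<le> (\<Sum>j\<in>UNIV. exp (lin_comb u \<theta> x + m * u j x) + exp (lin_comb u \<theta> x + (- m) * u j x))"
      by (simp add: exp_add exp_diff exp_minus sum_distrib_left distrib_left divide_inverse)
  qed measurable
  then show ?thesis using m(1) by (auto simp: regular_def intro!: exI[of _ ?s])
qed

text \<open>
  The domain of \<open>K\<close> is convex, hence so is its interior: a small ball around a convex combination
  consists of convex combinations of points in small balls around the two ends.
\<close>
lemma convex_param_space: "convex (param_space M p u)"
proof (rule convexI)
  fix \<theta>0 \<theta>1 :: "real^'d" and a t :: real
  assume \<theta>0: "\<theta>0 \<in> param_space M p u" and \<theta>1: "\<theta>1 \<in> param_space M p u"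
    and at: "0 \<le> a" "0 \<le> t" "a + t = 1"
  obtain \<epsilon>0 where \<epsilon>0: "0 < \<epsilon>0"
    "\<And>v. v \<in> B_space M p \<Longrightarrow> B_norm M p (\<lambda>x. v x - lin_comb u \<theta>0 x) < \<epsilon>0 \<Longrightarrow> v \<in> Dom_K M p"
    using \<theta>0 by (auto simp: param_space_def Dom_K_interior_def)
  obtain \<epsilon>1 where \<epsilon>1: "0 < \<epsilon>1"
    "\<And>v. v \<in> B_space M p \<Longrightarrow> B_norm M p (\<lambda>x. v x - lin_comb u \<theta>1 x) < \<epsilon>1 \<Longrightarrow> v \<in> Dom_K M p"
    using \<theta>1 by (auto simp: param_space_def Dom_K_interior_def)
  let ?\<theta> = "a *\<^sub>R \<theta>0 + t *\<^sub>R \<theta>1"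
  have "w \<in> Dom_K M p"
    if w: "w \<in> B_space M p" and small: "B_norm M p (\<lambda>x. w x - lin_comb u ?\<theta> x) < min \<epsilon>0 \<epsilon>1" for w
  proof -
    note [measurable] = B_space_measurable[OF w]
    define r where "r x = w x - lin_comb u ?\<theta> x" for x
    have r: "r \<in> B_space M p"
      using B_space_lin[OF w lin_comb_B_space, of 1 "-1" ?\<theta>] by (simp add: r_def[abs_def])
    have shifted: "(\<lambda>x. lin_comb u \<eta> x + r x) \<in> B_space M p" for \<eta>
      using B_space_lin[OF lin_comb_B_space r, of 1 \<eta> 1] by simp
    have "B_norm M p r < \<epsilon>0" "B_norm M p r < \<epsilon>1"
      using small by (simp_all add: r_def[abs_def])
    then have "(\<lambda>x. lin_comb u \<theta>0 x + r x) \<in> Dom_K M p" "(\<lambda>x. lin_comb u \<theta>1 x + r x) \<in> Dom_K M p"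
      using \<epsilon>0(2)[OF shifted] \<epsilon>1(2)[OF shifted] by simp_all
    then have "integrable M (\<lambda>x. a * (exp (lin_comb u \<theta>0 x + r x) * p x) + t * (exp (lin_comb u \<theta>1 x + r x) * p x))"
      unfolding Dom_K_iff by (intro Bochner_Integration.integrable_add integrable_mult_right) simp_all
    then have "integrable M (\<lambda>x. (a * exp (lin_comb u \<theta>0 x + r x) + t * exp (lin_comb u \<theta>1 x + r x)) * p x)"
      by (simp add: algebra_simps)
    then have "integrable M (\<lambda>x. exp (w x) * p x)"
    proof (rule integrable_dominated)
      fix x
      have a: "a = 1 - t" using at by simp
      have "w x = (1 - t) * (lin_comb u \<theta>0 x + r x) + t * (lin_comb u \<theta>1 x + r x)"
        by (simp add: r_def lin_comb_add lin_comb_scaleR a right_diff_distrib left_diff_distrib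
            distrib_left del: scaleR_left_diff_distrib)
      then show "\<bar>exp (w x)\<bar> \<le> a * exp (lin_comb u \<theta>0 x + r x) + t * exp (lin_comb u \<theta>1 x + r x)"
        using exp_le_chord[of t "lin_comb u \<theta>0 x + r x" "lin_comb u \<theta>1 x + r x"] at by (simp add: a)
    qed measurable
    then show ?thesis using w by (simp add: Dom_K_iff)
  qed
  then show "?\<theta> \<in> param_space M p u"
    using \<epsilon>0(1) \<epsilon>1(1) lin_comb_B_space
    by (auto simp: param_space_def Dom_K_interior_def intro!: exI[of _ "min \<epsilon>0 \<epsilon>1"])
qed

lemma exp_lin_comb_shift_le:
  "norm (\<eta> - \<theta>) \<le> s \<Longrightarrow> exp (lin_comb u \<eta> x) \<le> exp (lin_comb u \<theta> x + s * abs_sum x)"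
  using lin_comb_le_abs_sum[of "\<eta> - \<theta>" x] mult_right_mono[OF _ abs_sum_nonneg, of "norm (\<eta> - \<theta>)" s x]
  by (simp add: lin_comb_diff)

lemma open_regular: "open regular"
  unfolding open_dist
proof
  fix \<theta> assume "\<theta> \<in> regular"
  then obtain s where s: "0 < s" "integrable M (\<lambda>x. exp (lin_comb u \<theta> x + s * abs_sum x) * p x)"
    by (auto simp: regular_def)
  have "\<eta> \<in> regular" if "dist \<eta> \<theta> < s / 2" for \<eta>
  proof -
    have "integrable M (\<lambda>x. exp (lin_comb u \<eta> x + s / 2 * abs_sum x) * p x)"
      using s(2)
    proof (rule integrable_dominated)
      fix x
      have "lin_comb u \<eta> x \<le> lin_comb u \<theta> x + s / 2 * abs_sum x"
        using exp_lin_comb_shift_le[of \<eta> \<theta> "s / 2" x] that by (simp add: dist_norm)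
      then show "\<bar>exp (lin_comb u \<eta> x + s / 2 * abs_sum x)\<bar> \<le> exp (lin_comb u \<theta> x + s * abs_sum x)"
        by simp
    qed measurable
    then show ?thesis using s(1) by (auto simp: regular_def intro!: exI[of _ "s / 2"])
  qed
  then show "\<exists>e>0. \<forall>\<eta>. dist \<eta> \<theta> < e \<longrightarrow> \<eta> \<in> regular" using s(1) by (intro exI[of _ "s / 2"]) simp
qed

text \<open>
  All polynomials in the \<open>u\<^sub>j\<close> belong to this class, and its members can be integrated against
  \<open>exp(\<theta>\<cdot>u) p\<close> for every regular \<open>\<theta>\<close> by spending some of the margin.
\<close>
definition subexponential :: "('x \<Rightarrow> real) \<Rightarrow> bool" where
  "subexponential \<phi> \<longleftrightarrow> \<phi> \<in> borel_measurable M \<and>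
     (\<forall>s>0. \<exists>C. \<forall>x. \<bar>\<phi> x\<bar> \<le> C * exp (s * abs_sum x))"

lemma subexponential_1: "subexponential (\<lambda>x. 1)"
  unfolding subexponential_def using abs_sum_nonneg by (auto intro!: exI[of _ 1])

lemma subexponential_abs_sum: "subexponential abs_sum"
proof -
  have "abs_sum x \<le> 1 / s * exp (s * abs_sum x)" if "0 < s" for s x
  proof -
    have "s * abs_sum x \<le> exp (s * abs_sum x)" using exp_ge_add_one_self[of "s * abs_sum x"] by linarith
    then show ?thesis using that by (simp add: field_simps)
  qed
  then show ?thesis unfolding subexponential_def using abs_sum_nonneg by (auto intro!: exI[of _ "1 / _"])
qed

lemma subexponential_u: "subexponential (u j)"
  unfolding subexponential_def
proof (intro conjI allI impI u_measurable)
  fix s :: real assume "0 < s"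
  then obtain C where C: "\<And>x. \<bar>abs_sum x\<bar> \<le> C * exp (s * abs_sum x)"
    using subexponential_abs_sum unfolding subexponential_def by blast
  have "\<bar>u j x\<bar> \<le> C * exp (s * abs_sum x)" for x
    using abs_u_le[of j x] C[of x] by linarith
  then show "\<exists>C. \<forall>x. \<bar>u j x\<bar> \<le> C * exp (s * abs_sum x)" by blast
qed

lemma subexponential_mult:
  assumes "subexponential \<phi>" "subexponential \<omega>"
  shows "subexponential (\<lambda>x. \<phi> x * \<omega> x)"
  unfolding subexponential_def
proof (intro conjI allI impI)
  show "(\<lambda>x. \<phi> x * \<omega> x) \<in> borel_measurable M"
    using assms unfolding subexponential_def by (intro borel_measurable_times) auto
  fix s :: real assume s: "0 < s"
  then obtain C D where C: "\<And>x. \<bar>\<phi> x\<bar> \<le> C * exp (s / 2 * abs_sum x)"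
    and D: "\<And>x. \<bar>\<omega> x\<bar> \<le> D * exp (s / 2 * abs_sum x)"
    using assms half_gt_zero[OF s] unfolding subexponential_def by blast
  have "\<bar>\<phi> x * \<omega> x\<bar> \<le> C * D * exp (s * abs_sum x)" for x
  proof -
    have "\<bar>\<phi> x * \<omega> x\<bar> \<le> (C * exp (s / 2 * abs_sum x)) * (D * exp (s / 2 * abs_sum x))"
      unfolding abs_mult by (intro mult_mono C D order_trans[OF abs_ge_zero C]) simp
    also have "\<dots> = C * D * exp (s * abs_sum x)"
      by (simp add: algebra_simps flip: exp_add)
    finally show ?thesis .
  qed
  then show "\<exists>C. \<forall>x. \<bar>\<phi> x * \<omega> x\<bar> \<le> C * exp (s * abs_sum x)" by blast
qed

definition moment :: "('x \<Rightarrow> real) \<Rightarrow> real^'d \<Rightarrow> real" where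
  "moment \<phi> \<theta> = (\<integral>x. (\<phi> x * exp (lin_comb u \<theta> x)) * p x \<partial>M)"

lemma moment_integrable:
  assumes "\<theta> \<in> regular" "subexponential \<phi>"
  shows "integrable M (\<lambda>x. (\<phi> x * exp (lin_comb u \<theta> x)) * p x)"
proof -
  obtain s where s: "0 < s" "integrable M (\<lambda>x. exp (lin_comb u \<theta> x + s * abs_sum x) * p x)"
    using assms(1) by (auto simp: regular_def)
  obtain C where C: "\<And>x. \<bar>\<phi> x\<bar> \<le> C * exp (s * abs_sum x)"
    using assms(2) s(1) unfolding subexponential_def by blast
  have [measurable]: "\<phi> \<in> borel_measurable M" using assms(2) by (simp add: subexponential_def)
  have "integrable M (\<lambda>x. (C * exp (lin_comb u \<theta> x + s * abs_sum x)) * p x)"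
    using integrable_mult_right[OF s(2), of C] by (simp add: mult.assoc)
  then show ?thesis
  proof (rule integrable_dominated)
    fix x
    show "\<bar>\<phi> x * exp (lin_comb u \<theta> x)\<bar> \<le> C * exp (lin_comb u \<theta> x + s * abs_sum x)"
      using mult_right_mono[OF C[of x], of "exp (lin_comb u \<theta> x)"]
      by (simp add: abs_mult exp_add mult_ac)
  qed measurable
qed

text \<open>
  Differentiation under the integral sign. For \<open>\<parallel>h\<parallel> \<le> s/2\<close> the remainder of \<open>exp(h\<cdot>u)\<close> is at most
  \<open>\<parallel>h\<parallel>\<^sup>2 (\<Sum>\<^sub>j \<bar>u\<^sub>j\<bar>)\<^sup>2 exp(s/2 \<Sum>\<^sub>j \<bar>u\<^sub>j\<bar>)\<close>, and the polynomial factor costs another \<open>s/2\<close> of the margin \<open>s\<close>.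
\<close>
lemma moment_derivative:
  assumes \<theta>: "\<theta> \<in> regular" and \<phi>: "subexponential \<phi>"
  shows "(moment \<phi> has_derivative (\<lambda>h. \<Sum>j\<in>UNIV. h $ j * moment (\<lambda>x. \<phi> x * u j x) \<theta>)) (at \<theta>)"
proof -
  obtain s where s: "0 < s" "integrable M (\<lambda>x. exp (lin_comb u \<theta> x + s * abs_sum x) * p x)"
    using \<theta> by (auto simp: regular_def)
  obtain \<delta>0 where \<delta>0: "0 < \<delta>0" "\<And>\<eta>. dist \<eta> \<theta> < \<delta>0 \<Longrightarrow> \<eta> \<in> regular"
    using open_regular \<theta> unfolding open_dist by blast
  define \<delta> where "\<delta> = min \<delta>0 (s / 2)"
  have \<delta>: "0 < \<delta>" using \<delta>0 s by (simp add: \<delta>_def)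
  have [measurable]: "\<phi> \<in> borel_measurable M" using \<phi> by (simp add: subexponential_def)
  define \<omega> where "\<omega> x = \<phi> x * (abs_sum x * abs_sum x)" for x
  have "subexponential \<omega>"
    unfolding \<omega>_def by (intro subexponential_mult \<phi> subexponential_abs_sum)
  then obtain C where C: "\<And>x. \<bar>\<omega> x\<bar> \<le> C * exp (s / 2 * abs_sum x)"
    using half_gt_zero[OF s(1)] unfolding subexponential_def by blast
  define I where "I = C * (\<integral>x. exp (lin_comb u \<theta> x + s * abs_sum x) * p x \<partial>M)"
  show ?thesis
  proof (rule has_derivative_if_quadratic_remainder[OF _ \<delta>, where C = I])
    show "bounded_linear (\<lambda>h. \<Sum>j\<in>UNIV. h $ j * moment (\<lambda>x. \<phi> x * u j x) \<theta>)"
      by (intro bounded_linear_sum bounded_linear_compose[OF bounded_linear_mult_left] bounded_linear_vec_nth)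
    fix h :: "real^'d" assume h: "norm h < \<delta>"
    have reg: "\<theta> + h \<in> regular" using h by (intro \<delta>0(2)) (simp add: dist_norm \<delta>_def)
    have hs: "norm h \<le> s / 2" using h by (simp add: \<delta>_def)
    let ?E = "\<lambda>x. exp (lin_comb u \<theta> x)" and ?y = "\<lambda>x. lin_comb u h x"
    have int_j: "integrable M (\<lambda>x. (\<phi> x * u j x * ?E x) * p x)" for j
      by (rule moment_integrable[OF \<theta> subexponential_mult[OF \<phi> subexponential_u]])
    have y_eq: "(\<phi> x * ?y x * ?E x) * p x = (\<Sum>j\<in>UNIV. h $ j * ((\<phi> x * u j x * ?E x) * p x))" for x
      by (simp add: lin_comb_def sum_distrib_left sum_distrib_right mult_ac)
    have int_y: "integrable M (\<lambda>x. (\<phi> x * ?y x * ?E x) * p x)"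
      unfolding y_eq by (intro Bochner_Integration.integrable_sum integrable_mult_right int_j)
    have L: "(\<Sum>j\<in>UNIV. h $ j * moment (\<lambda>x. \<phi> x * u j x) \<theta>) = (\<integral>x. (\<phi> x * ?y x * ?E x) * p x \<partial>M)"
      unfolding y_eq moment_def using int_j
      by (subst Bochner_Integration.integral_sum) (auto intro: integrable_mult_right)
    have "moment \<phi> (\<theta> + h) - moment \<phi> \<theta> - (\<Sum>j\<in>UNIV. h $ j * moment (\<lambda>x. \<phi> x * u j x) \<theta>)
      = (\<integral>x. (\<phi> x * exp (lin_comb u (\<theta> + h) x)) * p x - (\<phi> x * ?E x) * p x - (\<phi> x * ?y x * ?E x) * p x \<partial>M)"
      unfolding L unfolding moment_def
      using moment_integrable[OF reg \<phi>] moment_integrable[OF \<theta> \<phi>] int_y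
      by (simp add: Bochner_Integration.integral_diff Bochner_Integration.integrable_diff)
    also have "\<dots> = (\<integral>x. (\<phi> x * ?E x * (exp (?y x) - 1 - ?y x)) * p x \<partial>M)"
      by (rule Bochner_Integration.integral_cong) (simp_all add: lin_comb_add exp_add algebra_simps)
    finally have diff: "moment \<phi> (\<theta> + h) - moment \<phi> \<theta> - (\<Sum>j\<in>UNIV. h $ j * moment (\<lambda>x. \<phi> x * u j x) \<theta>)
      = (\<integral>x. (\<phi> x * ?E x * (exp (?y x) - 1 - ?y x)) * p x \<partial>M)" .
    have bound: "\<bar>\<phi> x * ?E x * (exp (?y x) - 1 - ?y x)\<bar>
      \<le> (norm h)\<^sup>2 * C * exp (lin_comb u \<theta> x + s * abs_sum x)" for x
    proof -
      let ?n = "abs_sum x"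
      have y: "\<bar>?y x\<bar> \<le> norm h * ?n" by (rule lin_comb_le_abs_sum)
      have "(?y x)\<^sup>2 \<le> (norm h * ?n)\<^sup>2" using power_mono[OF y, of 2] by simp
      moreover have "norm h * ?n \<le> s / 2 * ?n" by (intro mult_right_mono hs abs_sum_nonneg)
      ultimately have "\<bar>exp (?y x) - 1 - ?y x\<bar> \<le> (norm h * ?n)\<^sup>2 * exp (s / 2 * ?n)"
        using y by (intro order_trans[OF exp_second_order_remainder] mult_mono) auto
      then have "\<bar>\<phi> x * ?E x * (exp (?y x) - 1 - ?y x)\<bar>
          \<le> \<bar>\<phi> x * ?E x\<bar> * ((norm h * ?n)\<^sup>2 * exp (s / 2 * ?n))"
        unfolding abs_mult[of "\<phi> x * ?E x"] by (intro mult_left_mono) auto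
      also have "\<dots> = (norm h)\<^sup>2 * \<bar>\<omega> x\<bar> * (?E x * exp (s / 2 * ?n))"
        using abs_sum_nonneg[of x] by (simp add: \<omega>_def abs_mult power2_eq_square mult_ac)
      also have "\<dots> \<le> (norm h)\<^sup>2 * (C * exp (s / 2 * ?n)) * (?E x * exp (s / 2 * ?n))"
        by (intro mult_right_mono mult_left_mono C) auto
      also have "\<dots> = (norm h)\<^sup>2 * C * (?E x * (exp (s / 2 * ?n) * exp (s / 2 * ?n)))"
        by (simp only: mult_ac)
      also have "?E x * (exp (s / 2 * ?n) * exp (s / 2 * ?n)) = exp (lin_comb u \<theta> x + s * ?n)"
        by (simp add: exp_add[symmetric])
      finally show ?thesis .
    qed
    have dom: "integrable M (\<lambda>x. ((norm h)\<^sup>2 * C * exp (lin_comb u \<theta> x + s * abs_sum x)) * p x)"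
      using integrable_mult_right[OF s(2), of "(norm h)\<^sup>2 * C"] by (simp add: mult.assoc)
    have "integrable M (\<lambda>x. (\<phi> x * ?E x * (exp (?y x) - 1 - ?y x)) * p x)"
      by (rule integrable_dominated[OF dom _ bound]) measurable
    then have "norm (\<integral>x. (\<phi> x * ?E x * (exp (?y x) - 1 - ?y x)) * p x \<partial>M)
        \<le> (\<integral>x. ((norm h)\<^sup>2 * C * exp (lin_comb u \<theta> x + s * abs_sum x)) * p x \<partial>M)"
      using dom
    proof (rule integral_norm_le_AE)
      show "AE x in M. norm ((\<phi> x * ?E x * (exp (?y x) - 1 - ?y x)) * p x)
        \<le> ((norm h)\<^sup>2 * C * exp (lin_comb u \<theta> x + s * abs_sum x)) * p x"
        using p_pos
      proof (rule eventually_mono)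
        fix x assume "0 < p x"
        then show "norm ((\<phi> x * ?E x * (exp (?y x) - 1 - ?y x)) * p x)
          \<le> ((norm h)\<^sup>2 * C * exp (lin_comb u \<theta> x + s * abs_sum x)) * p x"
          using mult_right_mono[OF bound[of x], of "p x"] by (simp add: abs_mult[of _ "p x"])
      qed
    qed
    also have "\<dots> = I * (norm h)\<^sup>2"
      by (simp add: I_def mult.assoc)
    finally show "norm (moment \<phi> (\<theta> + h) - moment \<phi> \<theta> - (\<Sum>j\<in>UNIV. h $ j * moment (\<lambda>x. \<phi> x * u j x) \<theta>))
      \<le> I * (norm h)\<^sup>2" unfolding diff .
  qed
qed


section \<open>The matrix of second moments\<close>

lemma moment_1_pos:
  assumes "\<theta> \<in> regular"
  shows "0 < moment (\<lambda>x. 1) \<theta>"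
proof -
  have int: "integrable M (\<lambda>x. (1 * exp (lin_comb u \<theta> x)) * p x)"
    using moment_integrable[OF assms subexponential_1] .
  have nonneg: "AE x in M. 0 \<le> (1 * exp (lin_comb u \<theta> x)) * p x"
    using p_pos by (rule eventually_mono) simp
  have "moment (\<lambda>x. 1) \<theta> \<noteq> 0"
  proof
    assume "moment (\<lambda>x. 1) \<theta> = 0"
    then have "AE x in M. (1 * exp (lin_comb u \<theta> x)) * p x = 0"
      using integral_nonneg_eq_0_iff_AE[OF int nonneg] by (simp add: moment_def)
    with p_pos have "AE x in M. False" by eventually_elim simp
    then have "(\<integral>x. p x \<partial>M) = (\<integral>x. 0 \<partial>M)" by (intro integral_cong_AE) auto
    then show False using p_total by simp
  qed
  moreover have "0 \<le> moment (\<lambda>x. 1) \<theta>"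
    unfolding moment_def by (rule integral_nonneg_AE[OF nonneg])
  ultimately show ?thesis by simp
qed

lemma p_at_eq:
  assumes "\<theta> \<in> regular"
  shows "p_at M p u \<theta> x = exp (lin_comb u \<theta> x) * p x / moment (\<lambda>x. 1) \<theta>"
proof -
  have "nn_expect M p (\<lambda>x. exp (lin_comb u \<theta> x)) = ennreal (moment (\<lambda>x. 1) \<theta>)"
    using nn_expect_eq_expect[of "\<lambda>x. exp (lin_comb u \<theta> x)"] moment_integrable[OF assms subexponential_1]
    by (simp add: moment_def expect_def)
  then have "real_of_ereal (K M p (lin_comb u \<theta>)) = ln (moment (\<lambda>x. 1) \<theta>)"
    using moment_1_pos[OF assms] by (simp add: K_def)
  then show ?thesis
    using moment_1_pos[OF assms] by (simp add: p_at_def tilt_def exp_diff)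
qed

lemma expect_p_at:
  assumes "\<theta> \<in> regular"
  shows "expect M (p_at M p u \<theta>) \<phi> = moment \<phi> \<theta> / moment (\<lambda>x. 1) \<theta>"
  unfolding expect_def moment_def[of \<phi>] p_at_eq[OF assms] by (simp add: mult.assoc)

lemma subexponential_V: "subexponential (\<lambda>x. V u x $ i)"
  by (cases i) (simp_all add: V_def subexponential_1 subexponential_u)

lemma subexponential_VV: "subexponential (\<lambda>x. V u x $ i * V u x $ j)"
  by (intro subexponential_mult subexponential_V)

lemma S_mat_nth:
  assumes "\<theta> \<in> regular"
  shows "S_mat M p u \<theta> $ i $ j
    = moment (\<lambda>x. V u x $ i * V u x $ j) \<theta> / moment (\<lambda>x. 1) \<theta>"
  by (simp add: S_mat_def F_map_def expect_p_at[OF assms])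

text \<open>
  The partial derivative of \<open>\<theta> \<mapsto> \<E>\<^sub>\<theta>[V V\<^sup>T]\<close> in direction \<open>k\<close>, by the quotient rule: entrywise the covariance of
  \<open>V\<^sub>i V\<^sub>j\<close> and \<open>u\<^sub>k\<close> under \<open>p\<^sub>\<theta>\<close>.
\<close>
definition dS :: "'d \<Rightarrow> real^'d \<Rightarrow> real^('d option)^('d option)" where
  "dS k \<theta> = (\<chi> i j.
     (moment (\<lambda>x. V u x $ i * V u x $ j * u k x) \<theta> * moment (\<lambda>x. 1) \<theta>
       - moment (\<lambda>x. V u x $ i * V u x $ j) \<theta> * moment (\<lambda>x. 1 * u k x) \<theta>)
     / (moment (\<lambda>x. 1) \<theta>)\<^sup>2)"

lemma S_mat_derivative:
  assumes \<theta>: "\<theta> \<in> regular"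
  shows "(S_mat M p u has_derivative (\<lambda>h. \<Sum>k\<in>UNIV. h $ k *\<^sub>R dS k \<theta>)) (at \<theta>)"
proof (rule has_derivative_vec, rule has_derivative_vec)
  fix i j
  let ?\<phi> = "\<lambda>x. V u x $ i * V u x $ j" and ?Z = "moment (\<lambda>x. 1)"
  have Z: "?Z \<theta> \<noteq> 0" using moment_1_pos[OF \<theta>] by simp
  have "((\<lambda>\<eta>. moment ?\<phi> \<eta> / ?Z \<eta>) has_derivative
      (\<lambda>h. (\<Sum>k\<in>UNIV. h $ k *\<^sub>R dS k \<theta>) $ i $ j)) (at \<theta>)"
  proof (rule has_derivative_eq_rhs[OF has_derivative_divide'[OF
          moment_derivative[OF \<theta> subexponential_VV] moment_derivative[OF \<theta> subexponential_1] Z]])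
    show "(\<lambda>h. ((\<Sum>k\<in>UNIV. h $ k * moment (\<lambda>x. ?\<phi> x * u k x) \<theta>) * ?Z \<theta>
        - moment ?\<phi> \<theta> * (\<Sum>k\<in>UNIV. h $ k * moment (\<lambda>x. 1 * u k x) \<theta>)) / (?Z \<theta> * ?Z \<theta>))
      = (\<lambda>h. (\<Sum>k\<in>UNIV. h $ k *\<^sub>R dS k \<theta>) $ i $ j)"
    proof
      fix h :: "real^'d"
      have "(\<Sum>k\<in>UNIV. h $ k *\<^sub>R dS k \<theta>) $ i $ j = (\<Sum>k\<in>UNIV. h $ k * dS k \<theta> $ i $ j)"
        by (simp add: sum_component)
      also have "\<dots> = (\<Sum>k\<in>UNIV. (h $ k * moment (\<lambda>x. ?\<phi> x * u k x) \<theta> * ?Z \<theta>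
        - moment ?\<phi> \<theta> * (h $ k * moment (\<lambda>x. 1 * u k x) \<theta>)) / (?Z \<theta> * ?Z \<theta>))"
        by (intro sum.cong) (simp_all add: dS_def power2_eq_square right_diff_distrib mult_ac)
      finally show "((\<Sum>k\<in>UNIV. h $ k * moment (\<lambda>x. ?\<phi> x * u k x) \<theta>) * ?Z \<theta>
        - moment ?\<phi> \<theta> * (\<Sum>k\<in>UNIV. h $ k * moment (\<lambda>x. 1 * u k x) \<theta>)) / (?Z \<theta> * ?Z \<theta>)
        = (\<Sum>k\<in>UNIV. h $ k *\<^sub>R dS k \<theta>) $ i $ j"
        by (simp add: sum_divide_distrib[symmetric] sum_subtractf sum_distrib_left sum_distrib_right)
    qed
  qed
  then show "((\<lambda>\<eta>. S_mat M p u \<eta> $ i $ j) has_derivative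
      (\<lambda>h. (\<Sum>k\<in>UNIV. h $ k *\<^sub>R dS k \<theta>) $ i $ j)) (at \<theta>)"
    by (rule has_derivative_transform_within_open[OF _ open_regular \<theta>]) (simp add: S_mat_nth)
qed

lemma partial_S_eq:
  assumes "\<theta> \<in> regular"
  shows "partial_S M p u k \<theta> = dS k \<theta>"
proof -
  have "((\<lambda>h. \<theta> + h *\<^sub>R axis k 1) has_vector_derivative axis k 1) (at 0)"
    by (auto intro!: derivative_eq_intros)
  moreover have "(S_mat M p u has_derivative (\<lambda>h. \<Sum>k\<in>UNIV. h $ k *\<^sub>R dS k \<theta>)) (at (\<theta> + 0 *\<^sub>R axis k 1))"
    using S_mat_derivative[OF assms] by simp
  ultimately have "((S_mat M p u \<circ> (\<lambda>h. \<theta> + h *\<^sub>R axis k 1)) has_vector_derivative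
      (\<Sum>l\<in>UNIV. axis k 1 $ l *\<^sub>R dS l \<theta>)) (at 0)"
    by (rule vector_derivative_diff_chain_within[OF _ has_derivative_at_withinI])
  moreover have "(\<Sum>l\<in>UNIV. axis k 1 $ l *\<^sub>R dS l \<theta>) = dS k \<theta>"
    by (simp add: axis_def if_distrib[of "\<lambda>c. c *\<^sub>R _"] cong: if_cong)
  ultimately show ?thesis
    unfolding partial_S_def by (intro vector_derivative_at) (simp add: o_def)
qed

lemma dS_continuous: "continuous_on regular (dS k)"
proof -
  have m: "continuous_on regular (moment \<phi>)" if "subexponential \<phi>" for \<phi>
    using has_derivative_continuous[OF moment_derivative[OF _ that]]
    by (auto intro: continuous_at_imp_continuous_on)
  show ?thesis
    unfolding dS_def
    by (intro continuous_intros m subexponential_VV subexponential_1 subexponential_u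
        subexponential_mult ballI) (auto dest: moment_1_pos)
qed

lemma S_mat_symmetric: "\<theta> \<in> regular \<Longrightarrow> transpose (S_mat M p u \<theta>) = S_mat M p u \<theta>"
  by (simp add: vec_eq_iff transpose_def S_mat_nth mult.commute)

lemma S_mat_corner: "\<theta> \<in> regular \<Longrightarrow> S_mat M p u \<theta> $ None $ None = 1"
  using moment_1_pos[of \<theta>] by (simp add: S_mat_nth V_def)

lemma S_mat_quadratic:
  assumes \<theta>: "\<theta> \<in> regular"
  shows "integrable M (\<lambda>x. ((c \<bullet> V u x)\<^sup>2 * exp (lin_comb u \<theta> x)) * p x)"
    and "c \<bullet> (S_mat M p u \<theta> *v c) = moment (\<lambda>x. (c \<bullet> V u x)\<^sup>2) \<theta> / moment (\<lambda>x. 1) \<theta>"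
proof -
  have int: "integrable M (\<lambda>x. ((V u x $ i * V u x $ j) * exp (lin_comb u \<theta> x)) * p x)" for i j
    by (rule moment_integrable[OF \<theta> subexponential_VV])
  have sq: "(c \<bullet> V u x)\<^sup>2 = (\<Sum>i\<in>UNIV. \<Sum>j\<in>UNIV. (c $ i * c $ j) * (V u x $ i * V u x $ j))" for x
    by (simp add: inner_vec_def power2_eq_square sum_product mult_ac)
  have expand: "((c \<bullet> V u x)\<^sup>2 * exp (lin_comb u \<theta> x)) * p x = (\<Sum>i\<in>UNIV. \<Sum>j\<in>UNIV. (c $ i * c $ j) *
      (((V u x $ i * V u x $ j) * exp (lin_comb u \<theta> x)) * p x))" for x
    unfolding sq by (simp add: sum_distrib_right mult.assoc)
  show "integrable M (\<lambda>x. ((c \<bullet> V u x)\<^sup>2 * exp (lin_comb u \<theta> x)) * p x)"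
    unfolding expand by (intro Bochner_Integration.integrable_sum integrable_mult_right int)
  have "moment (\<lambda>x. (c \<bullet> V u x)\<^sup>2) \<theta> = (\<integral>x. (\<Sum>i\<in>UNIV. \<Sum>j\<in>UNIV. (c $ i * c $ j) *
      (((V u x $ i * V u x $ j) * exp (lin_comb u \<theta> x)) * p x)) \<partial>M)"
    unfolding moment_def expand ..
  also have "\<dots> = (\<Sum>i\<in>UNIV. \<Sum>j\<in>UNIV. (c $ i * c $ j) * moment (\<lambda>x. V u x $ i * V u x $ j) \<theta>)"
    using int by (simp add: moment_def Bochner_Integration.integral_sum Bochner_Integration.integrable_sum
        integrable_mult_right)
  finally have "moment (\<lambda>x. (c \<bullet> V u x)\<^sup>2) \<theta>
    = (\<Sum>i\<in>UNIV. \<Sum>j\<in>UNIV. (c $ i * c $ j) * moment (\<lambda>x. V u x $ i * V u x $ j) \<theta>)" .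
  then show "c \<bullet> (S_mat M p u \<theta> *v c) = moment (\<lambda>x. (c \<bullet> V u x)\<^sup>2) \<theta> / moment (\<lambda>x. 1) \<theta>"
    by (simp add: inner_vec_def matrix_vector_mult_def S_mat_nth[OF \<theta>] sum_distrib_left
        sum_divide_distrib mult_ac)
qed

lemma inner_V: "c \<bullet> V u x = c $ None + lin_comb u (\<chi> j. c $ Some j) x"
proof -
  have "c \<bullet> V u x = (\<Sum>i\<in>insert None (range Some). c $ i * V u x $ i)"
    by (simp add: inner_vec_def flip: UNIV_option_conv)
  also have "\<dots> = c $ None + (\<Sum>j\<in>UNIV. c $ Some j * u j x)"
    by (subst sum.insert) (auto simp: V_def sum.reindex)
  finally show ?thesis by (simp add: lin_comb_def)
qed

text \<open>
  Centred variables that are linearly independent are also affinely independent: taking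
  expectations shows that the constant is \<open>0\<close>.
\<close>
lemma lin_comb_const_imp_zero:
  assumes indep: "lin_indep_L2 M p u" and const: "AE x in M. lin_comb u \<theta> x = c"
  shows "\<theta> = 0 \<and> c = 0"
proof -
  have "expect M p (lin_comb u \<theta>) = (\<integral>x. c * p x \<partial>M)"
    unfolding expect_def using const by (intro integral_cong_AE) (auto elim!: eventually_mono)
  then have c: "c = 0"
    using B_space_expect[OF lin_comb_B_space] p_total by simp
  have "AE x in density M (\<lambda>x. ennreal (p x)). lin_comb u \<theta> x = 0"
    using const by (subst AE_density) (auto simp: c elim!: eventually_mono)
  then show ?thesis using indep c by (simp add: lin_indep_L2_def)
qed

lemma S_mat_spd:
  assumes indep: "lin_indep_L2 M p u" and \<theta>: "\<theta> \<in> regular"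
  shows "spd (S_mat M p u \<theta>)"
  unfolding spd_def
proof (intro conjI allI impI S_mat_symmetric[OF \<theta>])
  fix c :: "real^'d option" assume c: "c \<noteq> 0"
  let ?f = "\<lambda>x. ((c \<bullet> V u x)\<^sup>2 * exp (lin_comb u \<theta> x)) * p x"
  have int: "integrable M ?f" by (rule S_mat_quadratic(1)[OF \<theta>])
  have nonneg: "AE x in M. 0 \<le> ?f x" using p_pos by (rule eventually_mono) simp
  have "moment (\<lambda>x. (c \<bullet> V u x)\<^sup>2) \<theta> \<noteq> 0"
  proof
    assume "moment (\<lambda>x. (c \<bullet> V u x)\<^sup>2) \<theta> = 0"
    then have "AE x in M. ?f x = 0"
      using integral_nonneg_eq_0_iff_AE[OF int nonneg] by (simp add: moment_def)
    with p_pos have "AE x in M. lin_comb u (\<chi> j. c $ Some j) x = - c $ None"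
      by eventually_elim (simp add: inner_V eq_neg_iff_add_eq_0 add.commute)
    from lin_comb_const_imp_zero[OF indep this] have "c $ i = 0" for i
      by (cases i) (simp_all add: vec_eq_iff)
    then show False using c by (simp add: vec_eq_iff)
  qed
  moreover have "0 \<le> moment (\<lambda>x. (c \<bullet> V u x)\<^sup>2) \<theta>"
    unfolding moment_def by (rule integral_nonneg_AE[OF nonneg])
  ultimately show "0 < c \<bullet> (S_mat M p u \<theta> *v c)"
    using moment_1_pos[OF \<theta>] by (simp add: S_mat_quadratic(2)[OF \<theta>])
qed

text \<open>
  Let \<open>L\<close> be the logarithm of \<open>p\<^sub>\<theta> / p\<^sub>\<eta>\<close>, an affine function of the \<open>u\<^sub>j\<close>. Equal means give
  \<open>\<integral> L (p\<^sub>\<theta> - p\<^sub>\<eta>) = 0\<close>, the vanishing of the symmetrised Kullback--Leibler divergence. The integrand is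
  nonnegative, so \<open>L = 0\<close> almost everywhere.
\<close>
lemma mean_injective:
  assumes indep: "lin_indep_L2 M p u" and \<theta>: "\<theta> \<in> regular" and \<eta>: "\<eta> \<in> regular"
    and mean: "\<And>j. expect M (p_at M p u \<theta>) (u j) = expect M (p_at M p u \<eta>) (u j)"
  shows "\<theta> = \<eta>"
proof -
  let ?q = "p_at M p u"
  have int: "integrable M (\<lambda>x. \<phi> x * ?q \<zeta> x)" if "\<zeta> \<in> regular" "subexponential \<phi>" for \<zeta> \<phi>
  proof -
    have "integrable M (\<lambda>x. ((\<phi> x * exp (lin_comb u \<zeta> x)) * p x) / moment (\<lambda>x. 1) \<zeta>)"
      by (intro integrable_divide_zero moment_integrable that)
    then show ?thesis by (simp add: p_at_eq[OF that(1)] mult.assoc)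
  qed
  define c where "c = ln (moment (\<lambda>x. 1) \<theta>) - ln (moment (\<lambda>x. 1) \<eta>)"
  define L where "L x = lin_comb u (\<theta> - \<eta>) x - c" for x
  have one: "expect M (?q \<zeta>) (\<lambda>x. 1) = 1" if "\<zeta> \<in> regular" for \<zeta>
    using moment_1_pos[OF that] by (simp add: expect_p_at[OF that])
  have L_expect: "integrable M (\<lambda>x. L x * ?q \<zeta> x) \<and> expect M (?q \<zeta>) L
      = (\<Sum>j\<in>UNIV. (\<theta> - \<eta>) $ j * expect M (?q \<zeta>) (u j)) - c" if \<zeta>: "\<zeta> \<in> regular" for \<zeta>
  proof -
    have eq: "L x * ?q \<zeta> x = (\<Sum>j\<in>UNIV. (\<theta> - \<eta>) $ j * (u j x * ?q \<zeta> x)) - c * (1 * ?q \<zeta> x)" for x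
      by (simp add: L_def lin_comb_def left_diff_distrib sum_distrib_right mult.assoc)
    have iu: "integrable M (\<lambda>x. (\<theta> - \<eta>) $ j * (u j x * ?q \<zeta> x))" for j
      by (intro integrable_mult_right int \<zeta> subexponential_u)
    have i1: "integrable M (\<lambda>x. c * (1 * ?q \<zeta> x))"
      by (intro integrable_mult_right int \<zeta> subexponential_1)
    have isum: "integrable M (\<lambda>x. \<Sum>j\<in>UNIV. (\<theta> - \<eta>) $ j * (u j x * ?q \<zeta> x))"
      by (intro Bochner_Integration.integrable_sum iu)
    have "expect M (?q \<zeta>) L = (\<integral>x. (\<Sum>j\<in>UNIV. (\<theta> - \<eta>) $ j * (u j x * ?q \<zeta> x)) \<partial>M) - (\<integral>x. c * (1 * ?q \<zeta> x) \<partial>M)"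
      unfolding expect_def eq by (rule Bochner_Integration.integral_diff[OF isum i1])
    also have "(\<integral>x. (\<Sum>j\<in>UNIV. (\<theta> - \<eta>) $ j * (u j x * ?q \<zeta> x)) \<partial>M)
        = (\<Sum>j\<in>UNIV. (\<theta> - \<eta>) $ j * expect M (?q \<zeta>) (u j))"
      using iu by (subst Bochner_Integration.integral_sum) (simp_all add: expect_def)
    also have "(\<integral>x. c * (1 * ?q \<zeta> x) \<partial>M) = c * expect M (?q \<zeta>) (\<lambda>x. 1)"
      by (simp add: expect_def)
    finally show ?thesis
      using Bochner_Integration.integrable_diff[OF isum i1] by (simp add: eq one[OF \<zeta>])
  qed
  have q_ratio: "?q \<theta> x = exp (L x) * ?q \<eta> x" for x
    using moment_1_pos[OF \<theta>] moment_1_pos[OF \<eta>]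
    by (simp add: p_at_eq \<theta> \<eta> L_def c_def lin_comb_diff exp_diff)
  have q_pos: "AE x in M. 0 < ?q \<eta> x"
    using p_pos by (rule eventually_mono) (simp add: p_at_eq[OF \<eta>] moment_1_pos[OF \<eta>])
  have int': "integrable M (\<lambda>x. L x * ?q \<theta> x - L x * ?q \<eta> x)"
    using L_expect[OF \<theta>] L_expect[OF \<eta>] by (intro Bochner_Integration.integrable_diff) simp_all
  have nonneg: "AE x in M. 0 \<le> L x * ?q \<theta> x - L x * ?q \<eta> x"
    using q_pos
  proof (rule eventually_mono)
    fix x assume q: "0 < ?q \<eta> x"
    have "0 \<le> L x * (exp (L x) - 1)" by (simp add: zero_le_mult_iff) linarith
    then have "0 \<le> L x * (exp (L x) - 1) * ?q \<eta> x" using q by simp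
    then show "0 \<le> L x * ?q \<theta> x - L x * ?q \<eta> x" by (simp add: q_ratio algebra_simps)
  qed
  have "(\<integral>x. L x * ?q \<theta> x - L x * ?q \<eta> x \<partial>M) = expect M (?q \<theta>) L - expect M (?q \<eta>) L"
    unfolding expect_def using L_expect[OF \<theta>] L_expect[OF \<eta>]
    by (intro Bochner_Integration.integral_diff) simp_all
  also have "\<dots> = 0" using L_expect[OF \<theta>] L_expect[OF \<eta>] by (simp add: mean)
  finally have "AE x in M. L x * ?q \<theta> x - L x * ?q \<eta> x = 0"
    using integral_nonneg_eq_0_iff_AE[OF int' nonneg] by simp
  with q_pos have "AE x in M. lin_comb u (\<theta> - \<eta>) x = c"
  proof eventually_elim
    fix x assume "0 < ?q \<eta> x" "L x * ?q \<theta> x - L x * ?q \<eta> x = 0"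
    then have "L x = 0 \<or> exp (L x) = 1" by (simp add: q_ratio flip: right_diff_distrib)
    then show "lin_comb u (\<theta> - \<eta>) x = c" by (simp add: L_def)
  qed
  from lin_comb_const_imp_zero[OF indep this] show ?thesis by simp
qed

end

section \<open>Comparison of the two distances\<close>

lemma airm_sum_left: "airm S (\<Sum>k\<in>I. c k *\<^sub>R X k) Y = (\<Sum>k\<in>I. c k * airm S (X k) Y)"
proof -
  have lin: "linear (\<lambda>X. airm S X Y)"
    by (intro linearI) (simp_all add: airm_def trace_def matrix_matrix_mult_def sum.distrib
        algebra_simps sum_distrib_left sum_distrib_right)
  show ?thesis by (simp add: linear_sum[OF lin] linear_scale[OF lin])
qed

lemma airm_sum_right: "airm S X (\<Sum>k\<in>I. c k *\<^sub>R Y k) = (\<Sum>k\<in>I. c k * airm S X (Y k))"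
proof -
  have lin: "linear (\<lambda>Y. airm S X Y)"
    by (intro linearI) (simp_all add: airm_def trace_def matrix_matrix_mult_def sum.distrib
        algebra_simps sum_distrib_left sum_distrib_right)
  show ?thesis by (simp add: linear_sum[OF lin] linear_scale[OF lin])
qed

lemma airm_geodesic_self:
  fixes S :: "real^'n^'n"
  assumes "spd S"
  shows "airm_geodesic S S t = S"
proof -
  obtain C B :: "real^'n^'n" and w where CB: "C ** B = mat 1"
    and S: "S = transpose C ** C" "S = transpose C ** diag w ** C"
    and geo: "airm_geodesic S S t = transpose C ** diag (\<chi> i. w $ i powr t) ** C"
    using airm_simultaneous_diagonalisation[OF assms assms] by blast
  have tr: "transpose B ** transpose C = mat 1"
    using CB by (simp add: transpose_mat flip: matrix_transpose_mul)
  have "transpose B ** (transpose C ** C) ** B = transpose B ** (transpose C ** diag w ** C) ** B"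
    using S by simp
  then have "diag w = mat 1"
    by (simp add: matrix_mul_assoc[symmetric] matrix_cancel_left[OF tr] CB)
  then have "diag w $ i $ i = mat 1 $ i $ i" for i by simp
  then have "w $ i = 1" for i by (simp add: diag_nth mat_def)
  then show ?thesis unfolding geo by (simp add: diag_one S(1)[symmetric])
qed

lemma d_airm_nonneg: "0 \<le> d_airm A B"
  by (simp add: d_airm_def)

context exponential_family
begin

lemma pullback_metric_quadratic:
  assumes "\<theta> \<in> regular"
  shows "v \<bullet> (pullback_metric M p u \<theta> *v v)
    = airm (S_mat M p u \<theta>) (\<Sum>k\<in>UNIV. v $ k *\<^sub>R dS k \<theta>) (\<Sum>k\<in>UNIV. v $ k *\<^sub>R dS k \<theta>)"
  unfolding airm_sum_left
  by (simp add: airm_sum_right inner_vec_def matrix_vector_mult_def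
      pullback_metric_def partial_S_eq[OF assms] sum_distrib_left mult_ac)

lemma S_mat_path:
  assumes indep: "lin_indep_L2 M p u" and \<gamma>: "smooth_path \<gamma>" "\<gamma> ` {0..1} \<subseteq> param_space M p u"
  shows "\<exists>S'. spd_path (\<lambda>t. S_mat M p u (\<gamma> t)) S' \<and>
    pullback_length M p u \<gamma> = airm_length (\<lambda>t. S_mat M p u (\<gamma> t)) S'"
proof -
  obtain D where D0: "\<And>t. t \<in> {0..1} \<Longrightarrow> D 0 t = \<gamma> t"
    and D: "\<And>k t. t \<in> {0..1} \<Longrightarrow> (D k has_vector_derivative D (Suc k) t) (at t within {0..1})"
    using \<gamma>(1) unfolding smooth_path_def by blast
  define v where "v = D 1"
  have reg: "\<gamma> t \<in> regular" if "t \<in> {0..1}" for t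
    using \<gamma>(2) that by (intro param_space_regular) auto
  have \<gamma>': "(\<gamma> has_vector_derivative v t) (at t within {0..1})" if t: "t \<in> {0..1}" for t
    using has_vector_derivative_transform[OF t D0[symmetric] D[OF t, of 0]] by (simp add: v_def)
  have cont: "continuous_on {0..1} v" "continuous_on {0..1} \<gamma>"
    using has_vector_derivative_continuous[OF D[of _ 1]] has_vector_derivative_continuous[OF \<gamma>']
    by (simp_all add: v_def continuous_on_eq_continuous_within)
  define S' where "S' t = (\<Sum>k\<in>UNIV. v t $ k *\<^sub>R dS k (\<gamma> t))" for t
  have "continuous_on {0..1} (\<lambda>t. dS k (\<gamma> t))" for k
    by (rule continuous_on_compose2[OF dS_continuous cont(2)]) (use reg in auto)
  then have "continuous_on {0..1} S'"
    unfolding S'_def by (intro continuous_intros cont)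
  moreover have "transpose (S' t) = S' t" for t
  proof -
    have "S' t $ i $ j = S' t $ j $ i" for i j
    proof -
      have "dS k (\<gamma> t) $ i $ j = dS k (\<gamma> t) $ j $ i" for k
        by (simp add: dS_def mult.commute)
      then show ?thesis by (simp add: S'_def sum_component)
    qed
    then show ?thesis by (simp add: vec_eq_iff transpose_def)
  qed
  moreover have "((\<lambda>t. S_mat M p u (\<gamma> t)) has_vector_derivative S' t) (at t within {0..1})"
    if t: "t \<in> {0..1}" for t
    using vector_derivative_diff_chain_within[OF \<gamma>'[OF t] has_derivative_at_withinI[OF S_mat_derivative[OF reg[OF t]]]]
    by (simp add: o_def S'_def)
  ultimately have "spd_path (\<lambda>t. S_mat M p u (\<gamma> t)) S'"
    using S_mat_spd[OF indep reg] by (simp add: spd_path_def)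
  moreover have "pullback_length M p u \<gamma> = airm_length (\<lambda>t. S_mat M p u (\<gamma> t)) S'"
    unfolding pullback_length_def airm_length_def
  proof (rule integral_cong)
    fix t :: real assume t: "t \<in> {0..1}"
    have "vector_derivative \<gamma> (at t within {0..1}) = v t"
      using t by (intro vector_derivative_within_closed_interval \<gamma>') auto
    then show "(let v = vector_derivative \<gamma> (at t within {0..1})
        in sqrt (v \<bullet> (pullback_metric M p u (\<gamma> t) *v v)))
      = airm_speed (\<lambda>t. S_mat M p u (\<gamma> t)) S' t"
      by (simp add: Let_def pullback_metric_quadratic[OF reg[OF t]] airm_speed_def S'_def)
  qed
  ultimately show ?thesis by blast
qed

lemma smooth_path_segment: "smooth_path (\<lambda>t. a + t *\<^sub>R b)"
  unfolding smooth_path_def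
  by (intro exI[of _ "\<lambda>k t. if k = 0 then a + t *\<^sub>R b else if k = 1 then b else 0"])
     (auto intro!: derivative_eq_intros)

lemma S_mat_mean: "S_mat M p u \<theta> $ Some j $ None = expect M (p_at M p u \<theta>) (u j)"
  by (simp add: S_mat_def F_map_def V_def)

text \<open>
  The last column of the second-moment matrix holds the means \<open>\<E>\<^sub>\<theta>[u\<^sub>j]\<close>.
\<close>
lemma S_mat_column_injective:
  assumes "lin_indep_L2 M p u" "\<theta> \<in> regular" "\<eta> \<in> regular"
    and col: "S_mat M p u \<eta> *v axis None 1 = S_mat M p u \<theta> *v axis None 1"
  shows "\<theta> = \<eta>"
proof (rule mean_injective[OF assms(1-3)])
  fix j
  have "(S_mat M p u \<eta> *v axis None 1) $ Some j = (S_mat M p u \<theta> *v axis None 1) $ Some j"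
    by (simp add: col)
  then show "expect M (p_at M p u \<theta>) (u j) = expect M (p_at M p u \<eta>) (u j)"
    by (simp add: matrix_vector_mult_basis column_def S_mat_mean)
qed

text \<open>
  The set whose infimum is the pullback distance of \<open>p\<^sub>\<theta>\<close> and \<open>p\<^sub>\<eta>\<close>.
\<close>
definition path_lengths :: "real^'d \<Rightarrow> real^'d \<Rightarrow> real set" where
  "path_lengths \<theta> \<eta> = {pullback_length M p u \<gamma> | \<gamma>.
     smooth_path \<gamma> \<and> \<gamma> ` {0..1} \<subseteq> param_space M p u \<and>
     p_at M p u (\<gamma> 0) = p_at M p u \<theta> \<and> p_at M p u (\<gamma> 1) = p_at M p u \<eta>}"

lemma path_lengths_realised:
  assumes indep: "lin_indep_L2 M p u" and l: "l \<in> path_lengths \<theta> \<eta>"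
  shows "\<exists>S S'. spd_path S S' \<and> S 0 = S_mat M p u \<theta> \<and> S 1 = S_mat M p u \<eta> \<and>
    (\<forall>t\<in>{0..1}. S t $ None $ None = 1) \<and> airm_length S S' = l"
proof -
  obtain \<gamma> where \<gamma>: "smooth_path \<gamma>" "\<gamma> ` {0..1} \<subseteq> param_space M p u"
    and ends: "p_at M p u (\<gamma> 0) = p_at M p u \<theta>" "p_at M p u (\<gamma> 1) = p_at M p u \<eta>"
    and len: "l = pullback_length M p u \<gamma>"
    using l by (auto simp: path_lengths_def)
  obtain S' where "spd_path (\<lambda>t. S_mat M p u (\<gamma> t)) S'"
    "pullback_length M p u \<gamma> = airm_length (\<lambda>t. S_mat M p u (\<gamma> t)) S'"
    using S_mat_path[OF indep \<gamma>] by blast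
  moreover have "S_mat M p u (\<gamma> t) $ None $ None = 1" if "t \<in> {0..1}" for t
    using \<gamma>(2) that by (intro S_mat_corner param_space_regular) auto
  moreover have "S_mat M p u (\<gamma> 0) = S_mat M p u \<theta>" "S_mat M p u (\<gamma> 1) = S_mat M p u \<eta>"
    using ends by (simp_all add: S_mat_def)
  ultimately show ?thesis using len by (intro exI[of _ "\<lambda>t. S_mat M p u (\<gamma> t)"] exI[of _ S']) simp
qed

lemma d_airm_le_path_length:
  assumes "lin_indep_L2 M p u" "l \<in> path_lengths \<theta> \<eta>"
  shows "d_airm (S_mat M p u \<theta>) (S_mat M p u \<eta>) \<le> l"
proof -
  obtain S S' where S: "spd_path S S'" "S 0 = S_mat M p u \<theta>" "S 1 = S_mat M p u \<eta>" "airm_length S S' = l"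
    using path_lengths_realised[OF assms] by blast
  show ?thesis using d_airm_le_length[OF S(1)] unfolding S(2-4) .
qed

lemma path_lengths_nonempty:
  assumes "\<theta> \<in> param_space M p u" "\<eta> \<in> param_space M p u"
  shows "path_lengths \<theta> \<eta> \<noteq> {}"
proof -
  let ?\<gamma> = "\<lambda>t. \<theta> + t *\<^sub>R (\<eta> - \<theta>)"
  have "?\<gamma> t \<in> param_space M p u" if "t \<in> {0..1}" for t
    using convexD_alt[OF convex_param_space assms, of t] that by (simp add: algebra_simps)
  then have "pullback_length M p u ?\<gamma> \<in> path_lengths \<theta> \<eta>"
    unfolding path_lengths_def using smooth_path_segment[of \<theta> "\<eta> - \<theta>"] by fastforce
  then show ?thesis by blast
qed

lemma zero_in_path_lengths:
  assumes "\<theta> \<in> param_space M p u"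
  shows "0 \<in> path_lengths \<theta> \<theta>"
proof -
  have "vector_derivative (\<lambda>t. \<theta>) (at t within {0..1}) = 0" if "t \<in> {0..1}" for t :: real
    using that by (intro vector_derivative_within_closed_interval has_vector_derivative_const) auto
  then have "pullback_length M p u (\<lambda>t. \<theta>) = integral {0..1} (\<lambda>t::real. 0)"
    unfolding pullback_length_def by (intro integral_cong) (simp add: Let_def)
  then have "pullback_length M p u (\<lambda>t. \<theta>) = 0" by simp
  moreover have "smooth_path (\<lambda>t::real. \<theta>)" using smooth_path_segment[of \<theta> 0] by simp
  ultimately show ?thesis unfolding path_lengths_def using assms by force
qed

theorem d_airm_le_Inf_path_lengths:
  assumes "lin_indep_L2 M p u" "\<theta> \<in> param_space M p u" "\<eta> \<in> param_space M p u"
  shows "d_airm (S_mat M p u \<theta>) (S_mat M p u \<eta>) \<le> Inf (path_lengths \<theta> \<eta>)"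
  using path_lengths_nonempty[OF assms(2,3)] d_airm_le_path_length[OF assms(1)]
  by (intro cInf_greatest) auto

text \<open>
  Equality forces almost minimal paths in the image, whose last diagonal entry is \<open>1\<close> throughout; hence
  equal last columns and equal means.
\<close>
theorem d_airm_eq_Inf_path_lengths_iff:
  assumes indep: "lin_indep_L2 M p u" and \<theta>: "\<theta> \<in> param_space M p u" and \<eta>: "\<eta> \<in> param_space M p u"
  shows "d_airm (S_mat M p u \<theta>) (S_mat M p u \<eta>) = Inf (path_lengths \<theta> \<eta>) \<longleftrightarrow> \<theta> = \<eta>"
proof
  note reg = param_space_regular[OF \<theta>] param_space_regular[OF \<eta>]
  assume eq: "d_airm (S_mat M p u \<theta>) (S_mat M p u \<eta>) = Inf (path_lengths \<theta> \<eta>)"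
  show "\<theta> = \<eta>"
  proof (rule S_mat_column_injective[OF indep reg columns_eq_if_distance_approximated])
    show "spd (S_mat M p u \<theta>)" "spd (S_mat M p u \<eta>)" by (intro S_mat_spd indep reg)+
    fix \<epsilon> :: real assume "0 < \<epsilon>"
    then obtain l where l: "l \<in> path_lengths \<theta> \<eta>" "l < d_airm (S_mat M p u \<theta>) (S_mat M p u \<eta>) + \<epsilon>"
      using cInf_lessD[OF path_lengths_nonempty[OF \<theta> \<eta>], of "Inf (path_lengths \<theta> \<eta>) + \<epsilon>"] eq by auto
    then show "\<exists>S S'. spd_path S S' \<and> S 0 = S_mat M p u \<theta> \<and> S 1 = S_mat M p u \<eta> \<and>
        (\<forall>t\<in>{0..1}. S t $ None $ None = 1) \<and>
        airm_length S S' < d_airm (S_mat M p u \<theta>) (S_mat M p u \<eta>) + \<epsilon>"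
      using path_lengths_realised[OF indep l(1)] by blast
  qed
next
  assume "\<theta> = \<eta>"
  then have "Inf (path_lengths \<theta> \<eta>) \<le> 0"
    using zero_in_path_lengths[OF \<theta>] order_trans[OF d_airm_nonneg d_airm_le_path_length[OF indep]]
    by (intro cInf_lower bdd_belowI[of _ 0]) auto
  then show "d_airm (S_mat M p u \<theta>) (S_mat M p u \<eta>) = Inf (path_lengths \<theta> \<eta>)"
    using d_airm_le_Inf_path_lengths[OF assms] d_airm_nonneg[of "S_mat M p u \<theta>" "S_mat M p u \<eta>"] by linarith
qed

text \<open>
  Only the midpoint matters for the forward direction: its last diagonal entry is \<open>1\<close> if it lies in the
  image.
\<close>
theorem airm_geodesic_in_image_iff:
  assumes indep: "lin_indep_L2 M p u" and \<theta>: "\<theta> \<in> param_space M p u" and \<eta>: "\<eta> \<in> param_space M p u"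
  shows "(\<forall>t\<in>{0..1}. airm_geodesic (S_mat M p u \<theta>) (S_mat M p u \<eta>) t \<in> F_map M u ` exp_family M p u)
    \<longleftrightarrow> \<theta> = \<eta>"
proof
  note reg = param_space_regular[OF \<theta>] param_space_regular[OF \<eta>]
  assume "\<forall>t\<in>{0..1}. airm_geodesic (S_mat M p u \<theta>) (S_mat M p u \<eta>) t \<in> F_map M u ` exp_family M p u"
  then have "airm_geodesic (S_mat M p u \<theta>) (S_mat M p u \<eta>) (1/2) \<in> F_map M u ` exp_family M p u"
    by simp
  then obtain \<zeta> where "\<zeta> \<in> param_space M p u"
    "airm_geodesic (S_mat M p u \<theta>) (S_mat M p u \<eta>) (1/2) = S_mat M p u \<zeta>"
    by (auto simp: exp_family_def S_mat_def)
  then have "airm_geodesic (S_mat M p u \<theta>) (S_mat M p u \<eta>) (1/2) $ None $ None = 1"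
    using S_mat_corner[OF param_space_regular] by simp
  then show "\<theta> = \<eta>"
    by (intro S_mat_column_injective[OF indep reg columns_eq_if_geodesic_entry] S_mat_spd indep reg S_mat_corner)
next
  assume "\<theta> = \<eta>"
  moreover have "S_mat M p u \<theta> \<in> F_map M u ` exp_family M p u"
    using \<theta> by (auto simp: S_mat_def exp_family_def)
  ultimately show "\<forall>t\<in>{0..1}. airm_geodesic (S_mat M p u \<theta>) (S_mat M p u \<eta>) t \<in> F_map M u ` exp_family M p u"
    using airm_geodesic_self[OF S_mat_spd[OF indep param_space_regular[OF \<theta>]]] by simp
qed

end

theorem theorem7p1:
  fixes M :: "'x measure" and p q1 q2 :: "'x \<Rightarrow> real"
    and u :: "'d::finite \<Rightarrow> 'x \<Rightarrow> real" and \<theta>1 \<theta>2 :: "real^'d"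
  assumes "sigma_finite_measure M"
    and "p \<in> densities M"
    and "\<And>j. u j \<in> B_space M p"
    and "lin_indep_L2 M p u"
    and "q1 \<in> max_exp_model M p" and "q2 \<in> max_exp_model M p"
    and "has_m_projection M p u q1" and "has_m_projection M p u q2"
    and "\<theta>1 \<in> param_space M p u" and "p_at M p u \<theta>1 = m_projection M p u q1"
    and "\<theta>2 \<in> param_space M p u" and "p_at M p u \<theta>2 = m_projection M p u q2"
  shows "d_airm (S_mat M p u \<theta>1) (S_mat M p u \<theta>2) \<le> d_tilde M p u q1 q2 \<and>
    (d_airm (S_mat M p u \<theta>1) (S_mat M p u \<theta>2) = d_tilde M p u q1 q2 \<longleftrightarrow>
     (\<forall>t\<in>{0..1}. airm_geodesic (S_mat M p u \<theta>1) (S_mat M p u \<theta>2) t \<in> F_map M u ` exp_family M p u))"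
proof -
  interpret exponential_family M p u
    using assms(2,3) by unfold_locales
  have "d_tilde M p u q1 q2 = Inf (path_lengths \<theta>1 \<theta>2)"
    by (simp add: d_tilde_def d_pullback_def path_lengths_def flip: assms(10,12))
  then show ?thesis
    using d_airm_le_Inf_path_lengths[OF assms(4,9,11)]
      d_airm_eq_Inf_path_lengths_iff[OF assms(4,9,11)] airm_geodesic_in_image_iff[OF assms(4,9,11)]
    by simp
qed

end
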